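(* Let $d\in\mathbb{N}$, let $A=(A_1,\dots,A_d)$ be a $d$-tuple of strongly measurable random operators $A_i:\Omega\to\mathcal{L}(H)$ on a Hilbert space $H$, over a probability space $(\Omega,\mathbb{P})$, with $\mathbb{E}[\|A^\alpha\|^2]<\infty$ for all $\alpha\in\mathbb{F}_d^+$, and let $K(\alpha,\beta)=\mathbb{E}[A^\alpha(A^\beta)^*]$, $\alpha,\beta\in\mathbb{F}_d^+$, be its moment kernel. Let $K_\Sigma(\alpha,\beta)=\sum_{i=1}^d K(\alpha i,\beta i)$. The following are equivalent: (1) There exist a Hilbert space $\mathcal{K}$, a Cuntz family $S=(S_1,\dots,S_d)$ on $\mathcal{K}$ (i.e. $S_i^*S_j=\delta_{i,j}I_{\mathcal{K}}$ and $\sum_{i=1}^d S_iS_i^*=I_{\mathcal{K}}$), a projection $P\in\mathcal{L}(\mathcal{K})$, and an isometry $W:H\to\mathcal{K}$ such that $$K(\alpha,\beta)=W^*S^\alpha P(S^\beta)^*W,\qquad \alpha,\beta\in\mathbb{F}_d^+,$$ and $$\sum_{i=1}^d S_iPS_i^*\le P\quad\text{on } \mathcal{M}:=\overline{\mathrm{span}}\{(S^\gamma)^*WH:\gamma\in\mathbb{F}_d^+\}.$$ (2) $K_\Sigma\le K$, i.e. $K-K_\Sigma$ is positive definite. Moreover, for $S$ and $W$ as in (1), $K_\Sigma=K$ if and only if $$K(\alpha,\beta)=W^*S^\alpha(S^\beta)^*W,\qquad \alpha,\beta\in\mathbb{F}_d^+.$$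
   Context: $\mathbb{F}_d^+$ is the free semigroup on generators $\{1,\dots,d\}$ with neutral element $\emptyset$ (the empty word). For a tuple $T=(T_1,\dots,T_d)$ of operators and a word $\alpha=i_1\cdots i_k$, $T^\alpha:=T_{i_1}\cdots T_{i_k}$ and $T^\emptyset:=I$. $\mathcal{L}(H)$ denotes the bounded operators on $H$. Inner products are linear in the second variable. Expectations of operators are in the quadratic-form (weak) sense: $\langle u,K(\alpha,\beta)v\rangle=\mathbb{E}[\langle u,A^\alpha(A^\beta)^*v\rangle]$. A kernel $K:\mathbb{F}_d^+\times\mathbb{F}_d^+\to\mathcal{L}(H)$ is positive definite (p.d.) if $\sum_{i,j=1}^N\langle u_i,K(\alpha_i,\alpha_j)u_j\rangle\ge0$ for every finite family $\{(\alpha_j,u_j)\}_{j=1}^N\subset\mathbb{F}_d^+\times H$; $L\le K$ means $K-L$ is p.d. Projections are orthogonal projections. For operators $X,Y$ on $\mathcal{K}$, "$X\le Y$ on $\mathcal{M}$" means $\langle y,Xy\rangle\le\langle y,Yy\rangle$ for all $y\in\mathcal{M}$. *)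

theory Defs
  imports
    "HOL-Probability.Probability"
    "HOL-Library.Complex_Order"
    "HOL-Library.Function_Algebras"
begin

text \<open>
  A complex Hilbert space is a structure, not a type, so that one can quantify existentially over
  Hilbert spaces. Its vectors form a linear subspace \<open>carrier X\<close> of an ambient abelian group
  \<open>'a\<close>, on which \<open>scale X\<close> is a complex scalar multiplication; addition is that of
  \<open>'a\<close>. The inner product is an arbitrary one on \<open>carrier X\<close>, unrelated to any topology on
  \<open>'a\<close>. Only the behaviour of operators on carriers is relevant.
\<close>

record 'a inner_space =
  carrier :: "'a set"
  scale :: "complex \<Rightarrow> 'a \<Rightarrow> 'a"
  ip :: "'a \<Rightarrow> 'a \<Rightarrow> complex"

definition hnorm :: "'a inner_space \<Rightarrow> 'a \<Rightarrow> real" where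
  "hnorm X x = sqrt (Re (ip X x x))"

text \<open>The inner product is linear in the second argument; \<open><\<close> on complex numbers is the
  order of \<^theory>\<open>HOL-Library.Complex_Order\<close>, so that \<open>0 < z\<close> includes that \<open>z\<close> is real.\<close>

locale hilbert_space =
  fixes X :: "'a::ab_group_add inner_space"
  assumes vector_space: "vector_space (scale X)"
    and subspace: "module.subspace (scale X) (carrier X)"
    and ip_add: "\<lbrakk>x \<in> carrier X; y \<in> carrier X; z \<in> carrier X\<rbrakk>
      \<Longrightarrow> ip X x (y + z) = ip X x y + ip X x z"
    and ip_scale: "\<lbrakk>x \<in> carrier X; y \<in> carrier X\<rbrakk> \<Longrightarrow> ip X x (scale X a y) = a * ip X x y"
    and ip_cnj: "\<lbrakk>x \<in> carrier X; y \<in> carrier X\<rbrakk> \<Longrightarrow> ip X y x = cnj (ip X x y)"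
    and ip_pos: "\<lbrakk>x \<in> carrier X; x \<noteq> 0\<rbrakk> \<Longrightarrow> 0 < ip X x x"
    and complete: "\<lbrakk>\<And>n::nat. s n \<in> carrier X;
        \<And>e. e > 0 \<Longrightarrow> \<exists>N. \<forall>m\<ge>N. \<forall>n\<ge>N. hnorm X (s m - s n) < e\<rbrakk>
      \<Longrightarrow> \<exists>x\<in>carrier X. (\<lambda>n. hnorm X (s n - x)) \<longlonglongrightarrow> 0"

definition closed_span :: "'a::ab_group_add inner_space \<Rightarrow> 'a set \<Rightarrow> 'a set" where
  "closed_span X B = {x \<in> carrier X. \<exists>s::nat \<Rightarrow> 'a.
     (\<forall>n. s n \<in> module.span (scale X) B) \<and> (\<lambda>n. hnorm X (s n - x)) \<longlonglongrightarrow> 0}"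

definition bounded_op ::
  "'a::ab_group_add inner_space \<Rightarrow> 'b::ab_group_add inner_space \<Rightarrow> ('a \<Rightarrow> 'b) \<Rightarrow> bool" where
  "bounded_op X Y T \<longleftrightarrow>
     (\<forall>x\<in>carrier X. T x \<in> carrier Y) \<and>
     (\<forall>x\<in>carrier X. \<forall>y\<in>carrier X. T (x + y) = T x + T y) \<and>
     (\<forall>a. \<forall>x\<in>carrier X. T (scale X a x) = scale Y a (T x)) \<and>
     (\<exists>C. \<forall>x\<in>carrier X. hnorm Y (T x) \<le> C * hnorm X x)"

definition op_norm :: "'a::ab_group_add inner_space \<Rightarrow> ('a \<Rightarrow> 'a) \<Rightarrow> real" where
  "op_norm X T = (SUP x\<in>{x \<in> carrier X. hnorm X x \<le> 1}. hnorm X (T x))"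

definition hadjoint ::
  "'a inner_space \<Rightarrow> 'b inner_space \<Rightarrow> ('a \<Rightarrow> 'b) \<Rightarrow> 'b \<Rightarrow> 'a" where
  "hadjoint X Y T y =
     (THE x. x \<in> carrier X \<and> (\<forall>u\<in>carrier X. ip X u x = ip Y (T u) y))"

definition isometry ::
  "'a::ab_group_add inner_space \<Rightarrow> 'b::ab_group_add inner_space \<Rightarrow> ('a \<Rightarrow> 'b) \<Rightarrow> bool" where
  "isometry X Y W \<longleftrightarrow> bounded_op X Y W \<and> (\<forall>x\<in>carrier X. hnorm Y (W x) = hnorm X x)"

definition orth_projection :: "'a::ab_group_add inner_space \<Rightarrow> ('a \<Rightarrow> 'a) \<Rightarrow> bool" where
  "orth_projection X P \<longleftrightarrow> bounded_op X X P \<and>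
     (\<forall>x\<in>carrier X. P (P x) = P x \<and> hadjoint X X P x = P x)"

definition op_le_on ::
  "'a inner_space \<Rightarrow> 'a set \<Rightarrow> ('a \<Rightarrow> 'a) \<Rightarrow> ('a \<Rightarrow> 'a) \<Rightarrow> bool" where
  "op_le_on X V S T \<longleftrightarrow> (\<forall>y\<in>V. ip X y (S y) \<le> ip X y (T y))"

text \<open>
  The generators are the elements of a finite type \<open>'d\<close>, with \<open>d = CARD('d)\<close> (so
  \<open>d \<ge> 1\<close>), and \<open>'d list\<close> is the free semigroup with neutral element \<open>[]\<close>. Thus
  \<open>word_op T [i\<^sub>1, \<dots>, i\<^sub>k] = T i\<^sub>1 \<circ> \<dots> \<circ> T i\<^sub>k\<close>.
\<close>

definition word_op :: "('d \<Rightarrow> 'a \<Rightarrow> 'a) \<Rightarrow> 'd list \<Rightarrow> 'a \<Rightarrow> 'a" where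
  "word_op T \<alpha> = foldr T \<alpha>"

definition cuntz_family ::
  "'a::ab_group_add inner_space \<Rightarrow> ('d::finite \<Rightarrow> 'a \<Rightarrow> 'a) \<Rightarrow> bool" where
  "cuntz_family X S \<longleftrightarrow>
     (\<forall>i. bounded_op X X (S i)) \<and>
     (\<forall>i j. \<forall>x\<in>carrier X. hadjoint X X (S i) (S j x) = (if i = j then x else 0)) \<and>
     (\<forall>x\<in>carrier X. (\<Sum>i\<in>UNIV. S i (hadjoint X X (S i) x)) = x)"

type_synonym ('d, 'a) kernel = "'d list \<Rightarrow> 'd list \<Rightarrow> 'a \<Rightarrow> 'a"

definition positive_definite ::
  "'a::ab_group_add inner_space \<Rightarrow> ('d, 'a) kernel \<Rightarrow> bool" where
  "positive_definite X K \<longleftrightarrow>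
     (\<forall>(N::nat) \<alpha> u. (\<forall>j<N. u j \<in> carrier X) \<longrightarrow>
        0 \<le> (\<Sum>i<N. \<Sum>j<N. ip X (u i) (K (\<alpha> i) (\<alpha> j) (u j))))"

definition kernel_le ::
  "'a::ab_group_add inner_space \<Rightarrow> ('d, 'a) kernel \<Rightarrow> ('d, 'a) kernel \<Rightarrow> bool" where
  "kernel_le X L K \<longleftrightarrow> positive_definite X (\<lambda>\<alpha> \<beta> u. K \<alpha> \<beta> u - L \<alpha> \<beta> u)"

definition kernel_eq ::
  "'a inner_space \<Rightarrow> ('d, 'a) kernel \<Rightarrow> ('d, 'a) kernel \<Rightarrow> bool" where
  "kernel_eq X L K \<longleftrightarrow> (\<forall>\<alpha> \<beta>. \<forall>u\<in>carrier X. L \<alpha> \<beta> u = K \<alpha> \<beta> u)"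

definition shift_kernel :: "('d::finite, 'a::ab_group_add) kernel \<Rightarrow> ('d, 'a) kernel" where
  "shift_kernel K \<alpha> \<beta> u = (\<Sum>i\<in>UNIV. K (\<alpha> @ [i]) (\<beta> @ [i]) u)"

text \<open>
  Strong measurability of an operator-valued map: every orbit is a pointwise limit of simple
  functions. If the Hilbert space is separable this is Borel measurability of every orbit.
\<close>

definition random_operator ::
  "'w measure \<Rightarrow> 'a::ab_group_add inner_space \<Rightarrow> ('w \<Rightarrow> 'a \<Rightarrow> 'a) \<Rightarrow> bool" where
  "random_operator M X T \<longleftrightarrow>
     (\<forall>\<omega>\<in>space M. bounded_op X X (T \<omega>)) \<and>
     (\<forall>x\<in>carrier X. \<exists>s::nat \<Rightarrow> 'w \<Rightarrow> 'a.
        (\<forall>n. simple_function M (s n)) \<and>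
        (\<forall>\<omega>\<in>space M. (\<forall>n. s n \<omega> \<in> carrier X) \<and> (\<lambda>n. hnorm X (s n \<omega> - T \<omega> x)) \<longlonglongrightarrow> 0))"

text \<open>
  \<open>K \<alpha> \<beta>\<close> is the weak expectation of \<open>A\<^sup>\<alpha> (A\<^sup>\<beta>)\<^sup>*\<close>. This determines \<open>K\<close> on the
  carrier. Integrability of the matrix coefficients, which \<^const>\<open>has_bochner_integral\<close> includes,
  follows from square integrability of the norms if the Hilbert space is separable; in general it is
  what existence of the weak expectation means, since \<open>\<omega> \<mapsto> (A\<^sup>\<beta> \<omega>)\<^sup>* v\<close> is then only weakly
  measurable.
\<close>

definition moment_kernel ::
  "'w measure \<Rightarrow> 'a::ab_group_add inner_space \<Rightarrow> ('d \<Rightarrow> 'w \<Rightarrow> 'a \<Rightarrow> 'a) \<Rightarrow>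
   ('d, 'a) kernel \<Rightarrow> bool" where
  "moment_kernel M X A K \<longleftrightarrow> (\<forall>\<alpha> \<beta>.
     bounded_op X X (K \<alpha> \<beta>) \<and>
     (\<forall>u\<in>carrier X. \<forall>v\<in>carrier X.
        has_bochner_integral M
          (\<lambda>\<omega>. ip X u (word_op (\<lambda>i. A i \<omega>) \<alpha> (hadjoint X X (word_op (\<lambda>i. A i \<omega>) \<beta>) v)))
          (ip X u (K \<alpha> \<beta> v))))"

definition adjoint_orbit_span ::
  "'a::ab_group_add inner_space \<Rightarrow> 'b::ab_group_add inner_space \<Rightarrow>
   ('d \<Rightarrow> 'b \<Rightarrow> 'b) \<Rightarrow> ('a \<Rightarrow> 'b) \<Rightarrow> 'b set" where
  "adjoint_orbit_span H Y S W =
     closed_span Y {hadjoint Y Y (word_op S \<gamma>) (W h) | \<gamma> h. h \<in> carrier H}"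

text \<open>
  An existential statement over \<open>Y\<close> has to fix the element type \<open>'b\<close>. The type
  \<open>'d list \<times> 'h \<Rightarrow> complex\<close>, with \<open>'h\<close> the element type of \<open>H\<close>, loses nothing: it contains
  a copy of every Hilbert space whose dimension is at most the cardinality of \<open>'d list \<times> 'h\<close>
  (as square summable functions), hence of the closed span of \<open>W H\<close> under any countable
  family of bounded operators.
\<close>

definition cuntz_representation ::
  "'a::ab_group_add inner_space \<Rightarrow> ('d::finite, 'a) kernel \<Rightarrow> 'b::ab_group_add inner_space \<Rightarrow>
   ('d \<Rightarrow> 'b \<Rightarrow> 'b) \<Rightarrow> ('b \<Rightarrow> 'b) \<Rightarrow> ('a \<Rightarrow> 'b) \<Rightarrow> bool" where
  "cuntz_representation H K Y S P W \<longleftrightarrow>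
     hilbert_space Y \<and> cuntz_family Y S \<and> orth_projection Y P \<and> isometry H Y W \<and>
     kernel_eq H K
       (\<lambda>\<alpha> \<beta> v. hadjoint H Y W (word_op S \<alpha> (P (hadjoint Y Y (word_op S \<beta>) (W v))))) \<and>
     op_le_on Y (adjoint_orbit_span H Y S W)
       (\<lambda>y. \<Sum>i\<in>UNIV. S i (P (hadjoint Y Y (S i) y))) P"

end

theory Submission imports Defs begin

text \<open>
  The hard direction is (2) to (1). Let \<open>\<langle>v\<^sub>\<alpha> u, v\<^sub>\<beta> w\<rangle> = \<langle>u, K(\<alpha>, \<beta>) w\<rangle>\<close> be a Kolmogorov decomposition of \<open>K\<close>.
  By \<open>K\<^sub>\<Sigma> \<le> K\<close>, the maps \<open>v\<^sub>\<beta> u \<mapsto> v\<^sub>\<beta>\<^sub>i u\<close> form a column contraction. Adding countably many copies of the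
  decomposition space of the defect \<open>K - K\<^sub>\<Sigma>\<close>, with a shift acting on them, makes it a column isometry
  \<open>T\<close>, and the inductive limit of the spaces of formal sums of \<open>S\<^sup>\<gamma> x\<close> under the identifications
  \<open>x = \<Sum>\<^sub>i S\<^sub>i (T\<^sub>i x)\<close> carries a Cuntz family with \<open>S\<^sub>i\<^sup>* = T\<^sub>i\<close> on the original space. With \<open>P\<close> the projection onto
  the span of all \<open>v\<^sub>\<beta> u\<close> and \<open>W u = v\<^sub>\<emptyset> u\<close> one has \<open>P (S\<^sup>\<beta>)\<^sup>* W u = v\<^sub>\<beta> u\<close>. Everything is
  expressed by scalar Gram kernels on generators, so that one completion is enough.
\<close>

section \<open>Hilbert spaces, adjoints and projections\<close>

text \<open>Both directions rest on one identity. For y a finite sum of vectors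
  \<open>(S\<^sup>\<gamma>)\<^sup>* W u\<close>, the inequality in (1) says that the sum of the
  \<open>\<parallel>P S_i^* y\<parallel>^2\<close> is at most
  \<open>\<parallel>P y\<parallel>^2\<close>, and the gap between the two sides is the quadratic
  form of \<open>K - K_\<Sigma>\<close> at the data of y. So only the family S, P, W has to be
  built; its inequality is then positivity of the defect, passed to the closure by continuity. The
  obstacle is that the column on the vectors of K is merely contractive, so the orbit of
  \<open>W u\<close> must leave the range of P. The dilation confines what leaves it to a set that
  every \<open>S_i^*\<close> preserves and P annihilates. A second obstacle is the fixed element
  type. The dilation needs a word and a level besides the index \<open>'d list \<times> 'h\<close>
  of K. These extra indices are countable in number, so a surjection from
  \<open>'d list \<times> 'h\<close> still reaches all generators, and a vector can be identified
  with the function of its inner products with them.\<close>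

lemma quadratic_cauchy_schwarz:
  fixes a c :: real and b :: complex
  assumes "0 \<le> a" "0 \<le> c" and q: "\<And>t. 0 \<le> a + 2 * Re (t * b) + (cmod t)\<^sup>2 * c"
  shows "cmod b \<le> sqrt a * sqrt c"
proof (cases "b = 0")
  case False
  \<comment> \<open>This choice of t makes t * b real. What remains is a real quadratic in s, whose
    minimizer 1 / c is inserted below when c is positive.\<close>
  have q': "0 \<le> a - 2 * s * (cmod b)\<^sup>2 + s\<^sup>2 * (cmod b)\<^sup>2 * c" for s :: real
  proof -
    have "- of_real s * cnj b * b = - of_real (s * (cmod b)\<^sup>2)"
      by (simp only: of_real_mult complex_norm_square mult.commute mult.left_commute mult_minus_left mult_minus_right)
    then have "Re (- of_real s * cnj b * b) = - s * (cmod b)\<^sup>2" by (metis Re_complex_of_real mult_minus_left uminus_complex.sel(1))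
    moreover have "(cmod (- of_real s * cnj b))\<^sup>2 = s\<^sup>2 * (cmod b)\<^sup>2"
      by (simp add: norm_mult power_mult_distrib)
    ultimately show ?thesis using q[of "- of_real s * cnj b"] by simp
  qed
  have b: "0 < (cmod b)\<^sup>2" using False by simp
  have "c \<noteq> 0"
  proof
    assume "c = 0"
    \<comment> \<open>With c = 0 the expression is affine in s, and this s brings it to -1.\<close>
    then show False using q'[of "(a + 1) / (2 * (cmod b)\<^sup>2)"] b \<open>0 \<le> a\<close> by (simp add: field_simps)
  qed
  then have "0 < c" using assms(2) by simp
  have "(cmod b)\<^sup>2 \<le> a * c"
    using q'[of "1 / c"] \<open>0 < c\<close> by (simp add: field_simps power2_eq_square)
  then have "cmod b \<le> sqrt (a * c)" by (rule real_le_rsqrt)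
  then show ?thesis by (simp add: real_sqrt_mult)
qed (use assms in simp)

context hilbert_space
begin

interpretation V: vector_space "scale X" by (rule vector_space)

lemma zero_mem [simp]: "0 \<in> carrier X"
  and add_mem [simp]: "x \<in> carrier X \<Longrightarrow> y \<in> carrier X \<Longrightarrow> x + y \<in> carrier X"
  and scale_mem [simp]: "x \<in> carrier X \<Longrightarrow> scale X a x \<in> carrier X"
  and diff_mem [simp]: "x \<in> carrier X \<Longrightarrow> y \<in> carrier X \<Longrightarrow> x - y \<in> carrier X"
  and uminus_mem [simp]: "x \<in> carrier X \<Longrightarrow> - x \<in> carrier X"
  by (simp_all add: V.subspace_0 V.subspace_add V.subspace_scale V.subspace_diff V.subspace_neg subspace)

lemma sum_mem: "(\<And>i. i \<in> I \<Longrightarrow> f i \<in> carrier X) \<Longrightarrow> sum f I \<in> carrier X"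
  by (rule V.subspace_sum[OF subspace])

lemma scale_one [simp]: "scale X 1 x = x"
  by (rule V.scale_one)

lemma scale_minus_one: "scale X (- 1) x = - x"
  using V.scale_minus_left[of 1 x] by simp

lemma scale_zero_left [simp]: "scale X 0 x = 0"
  by (rule V.scale_zero_left)

lemma scale_zero_right [simp]: "scale X a 0 = 0"
  by (rule V.scale_zero_right)

lemma scale_scale: "scale X a (scale X b x) = scale X (a * b) x"
  by (rule V.scale_scale)

lemma scale_add_right: "scale X a (x + y) = scale X a x + scale X a y"
  by (rule V.scale_right_distrib)

lemma ip_add_left:
  "\<lbrakk>x \<in> carrier X; y \<in> carrier X; z \<in> carrier X\<rbrakk> \<Longrightarrow> ip X (x + y) z = ip X x z + ip X y z"
  by (metis add_mem complex_cnj_add ip_add ip_cnj)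

lemma ip_scale_left:
  "\<lbrakk>x \<in> carrier X; y \<in> carrier X\<rbrakk> \<Longrightarrow> ip X (scale X a x) y = cnj a * ip X x y"
  by (metis scale_mem complex_cnj_mult ip_scale ip_cnj)

lemma ip_zero_right [simp]: "x \<in> carrier X \<Longrightarrow> ip X x 0 = 0"
  using ip_scale[of x 0 0] by simp

lemma ip_zero_left [simp]: "x \<in> carrier X \<Longrightarrow> ip X 0 x = 0"
  using ip_scale_left[of 0 x 0] by simp

lemma ip_uminus_right: "\<lbrakk>x \<in> carrier X; y \<in> carrier X\<rbrakk> \<Longrightarrow> ip X x (- y) = - ip X x y"
  using ip_scale[of x y "- 1"] by (simp add: scale_minus_one)

lemma ip_uminus_left: "\<lbrakk>x \<in> carrier X; y \<in> carrier X\<rbrakk> \<Longrightarrow> ip X (- x) y = - ip X x y"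
  using ip_scale_left[of x y "- 1"] by (simp add: scale_minus_one)

lemma ip_diff_right:
  "\<lbrakk>x \<in> carrier X; y \<in> carrier X; z \<in> carrier X\<rbrakk> \<Longrightarrow> ip X x (y - z) = ip X x y - ip X x z"
  using ip_add[of x y "- z"] by (simp add: ip_uminus_right)

lemma ip_diff_left:
  "\<lbrakk>x \<in> carrier X; y \<in> carrier X; z \<in> carrier X\<rbrakk> \<Longrightarrow> ip X (x - y) z = ip X x z - ip X y z"
  using ip_add_left[of x "- y" z] by (simp add: ip_uminus_left)

lemma ip_sum_right:
  assumes "x \<in> carrier X" "\<And>i. i \<in> I \<Longrightarrow> f i \<in> carrier X"
  shows "ip X x (sum f I) = (\<Sum>i\<in>I. ip X x (f i))"
  using assms(2)
proof (induction I rule: infinite_finite_induct)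
  case (insert i I)
  then show ?case using assms(1) sum_mem[of I f] by (simp add: ip_add)
qed (use assms(1) in auto)

lemma ip_sum_left:
  assumes "x \<in> carrier X" "\<And>i. i \<in> I \<Longrightarrow> f i \<in> carrier X"
  shows "ip X (sum f I) x = (\<Sum>i\<in>I. ip X (f i) x)"
  using assms(2)
proof (induction I rule: infinite_finite_induct)
  case (insert i I)
  then show ?case using assms(1) sum_mem[of I f] by (simp add: ip_add_left)
qed (use assms(1) in auto)

lemma ip_sum_sum:
  assumes f: "\<And>i. i \<in> I \<Longrightarrow> f i \<in> carrier X" and g: "\<And>j. j \<in> J \<Longrightarrow> g j \<in> carrier X"
  shows "ip X (sum f I) (sum g J) = (\<Sum>i\<in>I. \<Sum>j\<in>J. ip X (f i) (g j))"
proof -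
  have "ip X (sum f I) (sum g J) = (\<Sum>i\<in>I. ip X (f i) (sum g J))"
    by (intro ip_sum_left sum_mem f g)
  also have "\<dots> = (\<Sum>i\<in>I. \<Sum>j\<in>J. ip X (f i) (g j))"
    by (intro sum.cong refl ip_sum_right f g)
  finally show ?thesis .
qed

lemma ip_self_nonneg: "x \<in> carrier X \<Longrightarrow> 0 \<le> ip X x x"
  using ip_pos[of x] by (cases "x = 0") (auto simp: less_le)

lemma ip_self: "x \<in> carrier X \<Longrightarrow> ip X x x = of_real ((hnorm X x)\<^sup>2)"
  using ip_self_nonneg[of x] by (auto simp: hnorm_def less_eq_complex_def complex_eq_iff)

lemma hnorm_nonneg [simp]: "x \<in> carrier X \<Longrightarrow> 0 \<le> hnorm X x"
  using ip_self_nonneg[of x] by (auto simp: hnorm_def less_eq_complex_def)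

lemma hnorm_zero [simp]: "hnorm X 0 = 0"
  by (simp add: hnorm_def)

lemma hnorm_square: "x \<in> carrier X \<Longrightarrow> (hnorm X x)\<^sup>2 = Re (ip X x x)"
  by (simp add: ip_self)

lemma hnorm_eq_zero [simp]: "x \<in> carrier X \<Longrightarrow> hnorm X x = 0 \<longleftrightarrow> x = 0"
  using ip_pos[of x] ip_self[of x] by (cases "x = 0") auto

lemma ip_self_eq_zero: "x \<in> carrier X \<Longrightarrow> ip X x x = 0 \<longleftrightarrow> x = 0"
  using ip_self[of x] by simp

lemma ip_ext:
  assumes "x \<in> carrier X" "y \<in> carrier X" "\<And>u. u \<in> carrier X \<Longrightarrow> ip X u x = ip X u y"
  shows "x = y"
proof -
  have "ip X (x - y) (x - y) = 0" using assms by (simp add: ip_diff_right)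
  then show ?thesis using ip_self_eq_zero[of "x - y"] assms by simp
qed

lemma hnorm_scale: "x \<in> carrier X \<Longrightarrow> hnorm X (scale X a x) = cmod a * hnorm X x"
proof -
  assume x: "x \<in> carrier X"
  have "ip X (scale X a x) (scale X a x) = of_real ((cmod a)\<^sup>2 * (hnorm X x)\<^sup>2)"
  proof -
    have "ip X (scale X a x) (scale X a x) = a * cnj a * ip X x x"
      using x by (simp add: ip_scale ip_scale_left)
    then show ?thesis using x ip_self[of x] complex_norm_square[of a] by simp
  qed
  then have "(hnorm X (scale X a x))\<^sup>2 = (cmod a * hnorm X x)\<^sup>2"
    using x hnorm_square[of "scale X a x"]
    by (simp only: scale_mem Re_complex_of_real power_mult_distrib)
  then show ?thesis using x by (simp add: power2_eq_iff_nonneg)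
qed

lemma hnorm_uminus: "x \<in> carrier X \<Longrightarrow> hnorm X (- x) = hnorm X x"
  using hnorm_scale[of x "- 1"] by (simp add: scale_minus_one)

lemma hnorm_diff_commute: "x \<in> carrier X \<Longrightarrow> y \<in> carrier X \<Longrightarrow> hnorm X (x - y) = hnorm X (y - x)"
  using hnorm_uminus[of "x - y"] by simp

lemma hnorm_add_square:
  assumes "x \<in> carrier X" "y \<in> carrier X"
  shows "(hnorm X (x + y))\<^sup>2 = (hnorm X x)\<^sup>2 + 2 * Re (ip X x y) + (hnorm X y)\<^sup>2"
  using assms ip_cnj[of x y] by (simp add: hnorm_square ip_add ip_add_left)

lemma cauchy_schwarz:
  assumes "x \<in> carrier X" "y \<in> carrier X"
  shows "cmod (ip X x y) \<le> hnorm X x * hnorm X y"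
proof -
  have "cmod (ip X x y) \<le> sqrt ((hnorm X x)\<^sup>2) * sqrt ((hnorm X y)\<^sup>2)"
  proof (rule quadratic_cauchy_schwarz)
    fix t
    have "(hnorm X (x + scale X t y))\<^sup>2 =
        (hnorm X x)\<^sup>2 + 2 * Re (t * ip X x y) + (cmod t)\<^sup>2 * (hnorm X y)\<^sup>2"
      using assms by (simp add: hnorm_add_square ip_scale hnorm_scale power_mult_distrib)
    then show "0 \<le> (hnorm X x)\<^sup>2 + 2 * Re (t * ip X x y) + (cmod t)\<^sup>2 * (hnorm X y)\<^sup>2"
      by (metis zero_le_power2)
  qed auto
  then show ?thesis using assms by simp
qed

lemma hnorm_triangle:
  assumes "x \<in> carrier X" "y \<in> carrier X"
  shows "hnorm X (x + y) \<le> hnorm X x + hnorm X y"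
proof (rule power2_le_imp_le)
  have "Re (ip X x y) \<le> hnorm X x * hnorm X y"
    using cauchy_schwarz[OF assms] complex_Re_le_cmod[of "ip X x y"] by linarith
  then show "(hnorm X (x + y))\<^sup>2 \<le> (hnorm X x + hnorm X y)\<^sup>2"
    using assms by (simp add: hnorm_add_square power2_sum)
qed (use assms in simp)

lemma hnorm_triangle_diff:
  assumes "x \<in> carrier X" "y \<in> carrier X"
  shows "\<bar>hnorm X x - hnorm X y\<bar> \<le> hnorm X (x - y)"
  using hnorm_triangle[of "x - y" y] hnorm_triangle[of "y - x" x] hnorm_diff_commute[OF assms] assms
  by simp

lemma hnorm_tendsto:
  assumes "\<And>n. s n \<in> carrier X" "x \<in> carrier X" "(\<lambda>n. hnorm X (s n - x)) \<longlonglongrightarrow> 0"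
  shows "(\<lambda>n. hnorm X (s n)) \<longlonglongrightarrow> hnorm X x"
proof (rule LIM_zero_cancel, rule Lim_null_comparison[OF _ assms(3)])
  show "\<forall>\<^sub>F n in sequentially. norm (hnorm X (s n) - hnorm X x) \<le> hnorm X (s n - x)"
    using hnorm_triangle_diff assms by simp
qed

lemma ip_tendsto:
  assumes "\<And>n. s n \<in> carrier X" "x \<in> carrier X" "z \<in> carrier X" "(\<lambda>n. hnorm X (s n - x)) \<longlonglongrightarrow> 0"
  shows "(\<lambda>n. ip X z (s n)) \<longlonglongrightarrow> ip X z x"
proof (rule LIM_zero_cancel, rule Lim_null_comparison)
  show "\<forall>\<^sub>F n in sequentially. norm (ip X z (s n) - ip X z x) \<le> hnorm X z * hnorm X (s n - x)"
    using assms cauchy_schwarz by (simp add: ip_diff_right[symmetric])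
  show "(\<lambda>n. hnorm X z * hnorm X (s n - x)) \<longlonglongrightarrow> 0"
    using tendsto_mult_left[OF assms(4), of "hnorm X z"] by simp
qed

end

text \<open>Formal linear combinations are lists of coefficient and index pairs, repetitions
  allowed, so that addition is append and no quotient is taken. The form is conjugate linear on the
  left, like \<open>ip\<close>.\<close>

definition kernel_form ::
  "('i \<Rightarrow> 'i \<Rightarrow> complex) \<Rightarrow> (complex \<times> 'i) list \<Rightarrow> (complex \<times> 'i) list \<Rightarrow> complex" where
  "kernel_form k l m = (\<Sum>(a, x)\<leftarrow>l. \<Sum>(b, y)\<leftarrow>m. cnj a * b * k x y)"

definition lincomb ::
  "'a::ab_group_add inner_space \<Rightarrow> ('i \<Rightarrow> 'a) \<Rightarrow> (complex \<times> 'i) list \<Rightarrow> 'a" where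
  "lincomb X e l = (\<Sum>(a, x)\<leftarrow>l. scale X a (e x))"

lemma lincomb_Nil [simp]: "lincomb X e [] = 0"
  and lincomb_Cons [simp]: "lincomb X e ((a, x) # l) = scale X a (e x) + lincomb X e l"
  and lincomb_append: "lincomb X e (l @ m) = lincomb X e l + lincomb X e m"
  by (simp_all add: lincomb_def)

context hilbert_space
begin

text \<open>
  The Riesz representation theorem for a conjugate linear functional given by its graph, as it is
  when its values are prescribed on a spanning family. The representing vector is the limit
  of a minimizing sequence of \<open>\<parallel>u\<parallel>\<^sup>2 - 2 Re p\<close> over \<open>(u, p) \<in> G\<close>.
\<close>

lemma riesz_graph:
  fixes G :: "('a \<times> complex) set"
  assumes G: "\<And>u p. (u, p) \<in> G \<Longrightarrow> u \<in> carrier X" "(0, 0) \<in> G"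
      "\<And>u p v q. \<lbrakk>(u, p) \<in> G; (v, q) \<in> G\<rbrakk> \<Longrightarrow> (u + v, p + q) \<in> G"
      "\<And>u p a. (u, p) \<in> G \<Longrightarrow> (scale X a u, cnj a * p) \<in> G"
    and C: "0 \<le> C" "\<And>u p. (u, p) \<in> G \<Longrightarrow> cmod p \<le> C * hnorm X u"
  shows "\<exists>x\<in>carrier X. hnorm X x \<le> C \<and> (\<forall>(u, p)\<in>G. ip X u x = p) \<and>
    (\<forall>z\<in>carrier X. (\<forall>(u, p)\<in>G. ip X u z = 0) \<longrightarrow> ip X z x = 0)"
proof -
  define J where "J = (\<lambda>(u, p). (hnorm X u)\<^sup>2 - 2 * Re p)"
  define m where "m = Inf (J ` G)"
  have lower: "- (C\<^sup>2) \<le> J g" if "g \<in> G" for g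
  proof -
    obtain u p where g: "g = (u, p)" by fastforce
    have "Re p \<le> C * hnorm X u" using C(2)[of u p] that g complex_Re_le_cmod[of p] by auto
    \<comment> \<open>Completing the square bounds \<open>J\<close> from below by - C^2.\<close>
    moreover have "0 \<le> (hnorm X u - C)\<^sup>2" by simp
    ultimately show ?thesis by (simp add: g J_def power2_diff mult_ac)
  qed
  then have bdd: "bdd_below (J ` G)" by (meson bdd_below.I2)
  then have m: "m \<le> J g" if "g \<in> G" for g
    unfolding m_def using that by (simp add: cINF_lower)
  have "\<exists>g\<in>G. J g < m + 1 / Suc n" for n
  proof -
    have "Inf (J ` G) < m + 1 / Suc n" unfolding m_def by simp
    then show ?thesis using cInf_less_iff[of "J ` G"] bdd G(2) by auto
  qed
  then obtain g where g: "\<And>n. g n \<in> G" "\<And>n. J (g n) < m + 1 / Suc n" by metis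
  define u where "u n = fst (g n)" for n
  define p where "p n = snd (g n)" for n
  have up: "(u n, p n) \<in> G" "J (u n, p n) < m + 1 / Suc n" for n
    using g by (simp_all add: u_def p_def)
  have uX [simp]: "u n \<in> carrier X" for n using up(1) G(1) by blast
  have "(hnorm X (u i - u j))\<^sup>2 \<le> 2 / Suc i + 2 / Suc j" for i j
  proof -
    \<comment> \<open>The midpoint also belongs to \<open>G\<close>. Its value is at least m, and
      the parallelogram law turns this into closeness of \<open>u i\<close> and
      \<open>u j\<close>.\<close>
    have "m \<le> J (scale X (1/2) (u i + u j), cnj (1/2) * (p i + p j))"
      by (intro m G up)
    then have "4 * m \<le> (hnorm X (u i + u j))\<^sup>2 - 4 * Re (p i) - 4 * Re (p j)"
      by (simp add: J_def hnorm_scale power_mult_distrib power2_eq_square field_simps)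
    moreover have "(hnorm X (u i - u j))\<^sup>2 + (hnorm X (u i + u j))\<^sup>2 = 2 * (hnorm X (u i))\<^sup>2 + 2 * (hnorm X (u j))\<^sup>2"
      using hnorm_add_square[of "u i" "- u j"] hnorm_add_square[of "u i" "u j"]
      by (simp add: hnorm_uminus ip_uminus_right)
    ultimately show ?thesis using up(2)[of i] up(2)[of j] by (simp add: J_def)
  qed
  note cau = this
  have "\<exists>x\<in>carrier X. (\<lambda>n. hnorm X (u n - x)) \<longlonglongrightarrow> 0"
  proof (rule complete)
    fix e :: real
    assume "e > 0"
    then obtain N where N: "1 / Suc N < e\<^sup>2 / 4"
      using nat_approx_posE[of "e\<^sup>2 / 4"] by auto
    have "hnorm X (u i - u j) < e" if "i \<ge> N" "j \<ge> N" for i j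
    proof -
      have "1 / Suc i \<le> 1 / Suc N" "1 / Suc j \<le> 1 / Suc N"
        using that by (simp_all add: frac_le)
      then have "(hnorm X (u i - u j))\<^sup>2 < e\<^sup>2" using cau[of i j] N by simp
      then show ?thesis using \<open>e > 0\<close> by (simp add: power2_less_imp_less)
    qed
    then show "\<exists>N. \<forall>i\<ge>N. \<forall>j\<ge>N. hnorm X (u i - u j) < e" by blast
  qed simp
  then obtain x where x [simp]: "x \<in> carrier X" and lim: "(\<lambda>n. hnorm X (u n - x)) \<longlonglongrightarrow> 0"
    by blast
  note ip_lim = ip_tendsto[of u x, OF uX x _ lim]
  have eq: "ip X v x = q" if vq: "(v, q) \<in> G" for v q
  proof -
    have v [simp]: "v \<in> carrier X" using vq G(1) by blast
    \<comment> \<open>Vanishing of the first variation at the limit: moving \<open>u n\<close> along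
      v gains at most 1 / Suc n, so in the limit the quadratic in t is nonnegative with constant
      term 0, which forces its linear coefficient to vanish.\<close>
    have "cmod (ip X v x - q) \<le> sqrt 0 * sqrt ((hnorm X v)\<^sup>2)"
    proof (rule quadratic_cauchy_schwarz)
      fix t
      have "- (1 / Suc n) \<le> 2 * Re (t * (ip X v (u n) - q)) + (cmod t)\<^sup>2 * (hnorm X v)\<^sup>2" for n
      proof -
        have "m \<le> J (u n + scale X (cnj t) v, p n + cnj (cnj t) * q)" by (intro m G up vq)
        moreover have "Re (cnj t * ip X (u n) v) = Re (t * ip X v (u n))"
          using ip_cnj[of v "u n"] by simp
        ultimately have "m \<le> J (u n, p n) + 2 * Re (t * (ip X v (u n) - q)) + (cmod t)\<^sup>2 * (hnorm X v)\<^sup>2"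
          by (simp add: J_def hnorm_add_square ip_scale hnorm_scale power_mult_distrib algebra_simps)
        then show ?thesis using up(2)[of n] by simp
      qed
      moreover have "(\<lambda>n. - (1 / Suc n)) \<longlonglongrightarrow> - 0" by (intro tendsto_minus LIMSEQ_Suc[OF lim_1_over_n])
      moreover have "(\<lambda>n. 2 * Re (t * (ip X v (u n) - q)) + (cmod t)\<^sup>2 * (hnorm X v)\<^sup>2)
          \<longlonglongrightarrow> 2 * Re (t * (ip X v x - q)) + (cmod t)\<^sup>2 * (hnorm X v)\<^sup>2"
        by (intro tendsto_intros ip_lim) simp
      ultimately have "- 0 \<le> 2 * Re (t * (ip X v x - q)) + (cmod t)\<^sup>2 * (hnorm X v)\<^sup>2"
        by (meson LIMSEQ_le)
      then show "0 \<le> 0 + 2 * Re (t * (ip X v x - q)) + (cmod t)\<^sup>2 * (hnorm X v)\<^sup>2" by simp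
    qed auto
    then show ?thesis by simp
  qed
  have "hnorm X x \<le> C"
  proof (rule ccontr)
    assume "\<not> ?thesis"
    have "cmod (ip X (u n) x) \<le> C * hnorm X (u n)" for n
      using eq[OF up(1)] C(2)[OF up(1)] by simp
    then have "cmod (ip X x (u n)) \<le> C * hnorm X (u n)" for n
      using ip_cnj[of x "u n"] by (metis complex_mod_cnj uX x)
    moreover have "(\<lambda>n. cmod (ip X x (u n))) \<longlonglongrightarrow> cmod (ip X x x)"
      by (intro tendsto_intros ip_lim) simp
    moreover have "(\<lambda>n. C * hnorm X (u n)) \<longlonglongrightarrow> C * hnorm X x"
      by (intro tendsto_intros hnorm_tendsto[OF _ _ lim]) simp_all
    ultimately have "cmod (ip X x x) \<le> C * hnorm X x"
      by (meson LIMSEQ_le)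
    then show False using \<open>\<not> hnorm X x \<le> C\<close> C(1) by (simp add: ip_self power2_eq_square norm_mult)
  qed
  \<comment> \<open>This places x in the closed span of the first components of \<open>G\<close>,
    expressed by orthogonality; projections are obtained from it.\<close>
  moreover have "ip X z x = 0" if z: "z \<in> carrier X" "\<forall>(u, p)\<in>G. ip X u z = 0" for z
  proof -
    have "ip X z (u n) = 0" for n using z up(1)[of n] ip_cnj[of "u n" z] by auto
    then show ?thesis using ip_lim[OF z(1)] by (simp add: LIMSEQ_const_iff)
  qed
  ultimately show ?thesis using eq x by blast
qed

lemma lincomb_mem: "(\<And>x. e x \<in> carrier X) \<Longrightarrow> lincomb X e l \<in> carrier X"
  by (induction l) auto

lemma lincomb_scale:
  "(\<And>x. e x \<in> carrier X) \<Longrightarrow> lincomb X e (map (map_prod ((*) a) id) l) = scale X a (lincomb X e l)"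
  by (induction l) (auto simp: scale_add_right scale_scale)

lemma ip_lincomb_left:
  assumes "\<And>x. e x \<in> carrier X" "z \<in> carrier X"
  shows "ip X (lincomb X e l) z = (\<Sum>(a, x)\<leftarrow>l. cnj a * ip X (e x) z)"
  using assms by (induction l) (auto simp: ip_add_left ip_scale_left lincomb_mem)

lemma ip_lincomb_right:
  assumes "\<And>x. e x \<in> carrier X" "z \<in> carrier X"
  shows "ip X z (lincomb X e l) = (\<Sum>(a, x)\<leftarrow>l. a * ip X z (e x))"
  using assms by (induction l) (auto simp: ip_add ip_scale lincomb_mem)

lemma ip_lincomb:
  assumes "\<And>x. e x \<in> carrier X"
  shows "ip X (lincomb X e l) (lincomb X e m) = kernel_form (\<lambda>x y. ip X (e x) (e y)) l m"
proof -
  have "ip X (lincomb X e l) (lincomb X e m) = (\<Sum>(a, x)\<leftarrow>l. cnj a * ip X (e x) (lincomb X e m))"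
    by (intro ip_lincomb_left lincomb_mem assms)
  also have "\<dots> = kernel_form (\<lambda>x y. ip X (e x) (e y)) l m"
    unfolding kernel_form_def
    by (simp add: ip_lincomb_right assms sum_list_const_mult[symmetric] split_def mult.assoc)
  finally show ?thesis .
qed

end

text \<open>Equal Gram matrices make \<open>e x \<mapsto> e' x\<close> an isometry on the closed
  span of the \<open>e x\<close>, and g is the image of f under its adjoint. Riesz yields g directly
  from the values on formal combinations, so the isometry is never extended by continuity. The last
  clause says that g lies in that closed span. Taking \<open>e' = e\<close> gives projections;
  prepending a letter gives the adjoints of the Cuntz isometries.\<close>

lemma gram_adjoint:
  fixes X :: "'a::ab_group_add inner_space" and Y :: "'b::ab_group_add inner_space"
    and e :: "'i \<Rightarrow> 'a" and e' :: "'i \<Rightarrow> 'b"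
  assumes X: "hilbert_space X" and Y: "hilbert_space Y"
    and e: "\<And>x. e x \<in> carrier X" and e': "\<And>x. e' x \<in> carrier Y"
    and gram: "\<And>x y. ip Y (e' x) (e' y) = ip X (e x) (e y)"
    and f: "f \<in> carrier Y"
  shows "\<exists>g\<in>carrier X. hnorm X g \<le> hnorm Y f \<and> (\<forall>x. ip X (e x) g = ip Y (e' x) f) \<and>
    (\<forall>z\<in>carrier X. (\<forall>x. ip X (e x) z = 0) \<longrightarrow> ip X z g = 0)"
proof -
  interpret X: hilbert_space X by (rule X)
  interpret Y: hilbert_space Y by (rule Y)
  define G where "G = range (\<lambda>l. (lincomb X e l, ip Y (lincomb Y e' l) f))"
  note [simp] = X.lincomb_mem[of e, OF e] Y.lincomb_mem[of e', OF e'] f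
  have n: "hnorm Y (lincomb Y e' l) = hnorm X (lincomb X e l)" for l
    unfolding hnorm_def using e e' by (simp add: X.ip_lincomb Y.ip_lincomb gram)
  have "\<exists>g\<in>carrier X. hnorm X g \<le> hnorm Y f \<and> (\<forall>(u, p)\<in>G. ip X u g = p) \<and>
    (\<forall>z\<in>carrier X. (\<forall>(u, p)\<in>G. ip X u z = 0) \<longrightarrow> ip X z g = 0)"
  proof (rule X.riesz_graph)
    show "(0, 0) \<in> G" unfolding G_def by (rule image_eqI[of _ _ "[]"]) auto
    show "(u + v, p + q) \<in> G" if "(u, p) \<in> G" "(v, q) \<in> G" for u p v q
    proof -
      from that obtain l m where "(u, p) = (lincomb X e l, ip Y (lincomb Y e' l) f)"
        "(v, q) = (lincomb X e m, ip Y (lincomb Y e' m) f)" unfolding G_def by blast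
      then show ?thesis
        unfolding G_def by (intro image_eqI[of _ _ "l @ m"]) (auto simp: lincomb_append Y.ip_add_left)
    qed
    show "(scale X a u, cnj a * p) \<in> G" if "(u, p) \<in> G" for u p a
    proof -
      from that obtain l where "(u, p) = (lincomb X e l, ip Y (lincomb Y e' l) f)"
        unfolding G_def by blast
      then show ?thesis
        unfolding G_def
        by (intro image_eqI[of _ _ "map (map_prod ((*) a) id) l"])
          (auto simp: X.lincomb_scale Y.lincomb_scale e e' Y.ip_scale_left)
    qed
    show "cmod p \<le> hnorm Y f * hnorm X u" if "(u, p) \<in> G" for u p
      using that Y.cauchy_schwarz[of _ f]
      by (auto simp: G_def n[symmetric] mult.commute[of "hnorm Y f"])
  qed (auto simp: G_def)
  then obtain g where g: "g \<in> carrier X" "hnorm X g \<le> hnorm Y f"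
    "\<And>l. ip X (lincomb X e l) g = ip Y (lincomb Y e' l) f"
    "\<And>z. z \<in> carrier X \<Longrightarrow> (\<And>l. ip X (lincomb X e l) z = 0) \<Longrightarrow> ip X z g = 0"
    unfolding G_def by auto
  have "ip X (e x) g = ip Y (e' x) f" for x
    using g(3)[of "[(1, x)]"] by simp
  moreover have "ip X z g = 0" if "z \<in> carrier X" "\<forall>x. ip X (e x) z = 0" for z
  proof (rule g(4)[OF that(1)])
    show "ip X (lincomb X e l) z = 0" for l
      using e that by (simp add: X.ip_lincomb_left split_def)
  qed
  ultimately show ?thesis using g(1,2) by blast
qed

section \<open>Bounded operators and their adjoints\<close>

lemma bounded_opD:
  assumes "bounded_op X Y T"
  shows bounded_op_mem: "x \<in> carrier X \<Longrightarrow> T x \<in> carrier Y"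
    and bounded_op_add: "\<lbrakk>x \<in> carrier X; y \<in> carrier X\<rbrakk> \<Longrightarrow> T (x + y) = T x + T y"
    and bounded_op_scale: "x \<in> carrier X \<Longrightarrow> T (scale X a x) = scale Y a (T x)"
  using assms unfolding bounded_op_def by blast+

lemma bounded_op_bound:
  assumes "hilbert_space X" "bounded_op X Y T"
  obtains C where "0 \<le> C" "\<And>x. x \<in> carrier X \<Longrightarrow> hnorm Y (T x) \<le> C * hnorm X x"
proof -
  interpret X: hilbert_space X by fact
  obtain C where "\<And>x. x \<in> carrier X \<Longrightarrow> hnorm Y (T x) \<le> C * hnorm X x"
    using assms(2) unfolding bounded_op_def by blast
  then have "hnorm Y (T x) \<le> max C 0 * hnorm X x" if "x \<in> carrier X" for x
    using that by (meson X.hnorm_nonneg max.cobounded1 mult_right_mono order_trans)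
  then show ?thesis using that[of "max C 0"] by simp
qed

context
  fixes X :: "'a::ab_group_add inner_space" and Y :: "'b::ab_group_add inner_space" and T
  assumes X: "hilbert_space X" and Y: "hilbert_space Y" and T: "bounded_op X Y T"
begin

interpretation X: hilbert_space X by (rule X)
interpretation Y: hilbert_space Y by (rule Y)

lemma bounded_op_zero: "T 0 = 0"
  using bounded_op_scale[OF T, of 0 0] by simp

lemma bounded_op_uminus: "x \<in> carrier X \<Longrightarrow> T (- x) = - T x"
  using bounded_op_scale[OF T, of x "- 1"] by (simp add: X.scale_minus_one Y.scale_minus_one)

lemma bounded_op_diff: "\<lbrakk>x \<in> carrier X; y \<in> carrier X\<rbrakk> \<Longrightarrow> T (x - y) = T x - T y"
  using bounded_op_add[OF T, of x "- y"] by (simp add: bounded_op_uminus)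

lemma bounded_op_sum: "(\<And>i. i \<in> I \<Longrightarrow> f i \<in> carrier X) \<Longrightarrow> T (sum f I) = (\<Sum>i\<in>I. T (f i))"
proof (induction I rule: infinite_finite_induct)
  case (insert i I)
  then show ?case by (simp add: bounded_op_add[OF T] X.sum_mem)
qed (simp_all add: bounded_op_zero)

lemma hadjoint_eqI:
  assumes "x \<in> carrier X" "\<And>u. u \<in> carrier X \<Longrightarrow> ip X u x = ip Y (T u) y"
  shows "hadjoint X Y T y = x"
  unfolding hadjoint_def
proof (rule the_equality)
  fix x'
  assume x': "x' \<in> carrier X \<and> (\<forall>u\<in>carrier X. ip X u x' = ip Y (T u) y)"
  then show "x' = x" using assms by (intro X.ip_ext) auto
qed (use assms in blast)

text \<open>Supplies the existence that the definite description in \<open>hadjoint\<close>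
  presupposes: Riesz is applied to the functional \<open>u \<mapsto> ip Y (T u) y\<close>.\<close>

lemma hadjoint:
  assumes y: "y \<in> carrier Y"
  shows hadjoint_mem: "hadjoint X Y T y \<in> carrier X"
    and ip_hadjoint_right: "\<And>u. u \<in> carrier X \<Longrightarrow> ip X u (hadjoint X Y T y) = ip Y (T u) y"
proof -
  obtain C where C: "0 \<le> C" "\<And>x. x \<in> carrier X \<Longrightarrow> hnorm Y (T x) \<le> C * hnorm X x"
    using bounded_op_bound[OF X T] by blast
  define G where "G = (\<lambda>u. (u, ip Y (T u) y)) ` carrier X"
  have "\<exists>x\<in>carrier X. hnorm X x \<le> C * hnorm Y y \<and> (\<forall>(u, p)\<in>G. ip X u x = p) \<and>
    (\<forall>z\<in>carrier X. (\<forall>(u, p)\<in>G. ip X u z = 0) \<longrightarrow> ip X z x = 0)"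
  proof (rule X.riesz_graph)
    show "(0, 0) \<in> G" using y by (auto simp: G_def bounded_op_zero intro!: image_eqI[of _ _ 0])
    show "(u + v, p + q) \<in> G" if "(u, p) \<in> G" "(v, q) \<in> G" for u p v q
      using that y by (auto simp: G_def bounded_opD[OF T] Y.ip_add_left)
    show "(scale X a u, cnj a * p) \<in> G" if "(u, p) \<in> G" for u p a
      using that y by (auto simp: G_def bounded_opD[OF T] Y.ip_scale_left)
    show "cmod p \<le> C * hnorm Y y * hnorm X u" if up: "(u, p) \<in> G" for u p
    proof -
      have u: "u \<in> carrier X" "p = ip Y (T u) y" using up by (auto simp: G_def)
      have "cmod p \<le> hnorm Y (T u) * hnorm Y y"
        unfolding u by (intro Y.cauchy_schwarz bounded_op_mem[OF T] u y)
      also have "\<dots> \<le> C * hnorm X u * hnorm Y y"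
        using C(2) u y by (simp add: mult_right_mono)
      finally show ?thesis by (simp add: mult_ac)
    qed
  qed (use C y in \<open>auto simp: G_def\<close>)
  then obtain x where x: "x \<in> carrier X" "\<And>u. u \<in> carrier X \<Longrightarrow> ip X u x = ip Y (T u) y"
    unfolding G_def by auto
  have "hadjoint X Y T y = x" using x by (rule hadjoint_eqI)
  then show "hadjoint X Y T y \<in> carrier X"
    "\<And>u. u \<in> carrier X \<Longrightarrow> ip X u (hadjoint X Y T y) = ip Y (T u) y"
    using x by auto
qed

lemma ip_hadjoint_left:
  "\<lbrakk>y \<in> carrier Y; u \<in> carrier X\<rbrakk> \<Longrightarrow> ip X (hadjoint X Y T y) u = ip Y y (T u)"
  using ip_hadjoint_right[of y u] X.ip_cnj[of u "hadjoint X Y T y"] Y.ip_cnj[of "T u" y]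
  by (simp add: hadjoint_mem bounded_op_mem[OF T])

lemma bounded_op_hadjoint: "bounded_op Y X (hadjoint X Y T)"
proof -
  obtain C where C: "0 \<le> C" "\<And>x. x \<in> carrier X \<Longrightarrow> hnorm Y (T x) \<le> C * hnorm X x"
    using bounded_op_bound[OF X T] by blast
  have "hnorm X (hadjoint X Y T y) \<le> C * hnorm Y y" if y: "y \<in> carrier Y" for y
  proof -
    define x where "x = hadjoint X Y T y"
    have x: "x \<in> carrier X" using y by (simp add: x_def hadjoint_mem)
    have "(hnorm X x)\<^sup>2 = cmod (ip X x x)"
      using x by (simp add: X.ip_self norm_power)
    also have "\<dots> = cmod (ip Y (T x) y)" using x y by (simp add: x_def ip_hadjoint_right)
    also have "\<dots> \<le> hnorm Y (T x) * hnorm Y y"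
      using x y by (simp add: Y.cauchy_schwarz bounded_op_mem[OF T])
    also have "\<dots> \<le> C * hnorm X x * hnorm Y y"
      using C(2) x y by (simp add: mult_right_mono)
    finally have "hnorm X x * hnorm X x \<le> hnorm X x * (C * hnorm Y y)"
      by (simp add: power2_eq_square mult_ac)
    then show ?thesis
      using x y C(1) unfolding x_def[symmetric]
      by (cases "hnorm X x = 0") (auto simp del: X.hnorm_eq_zero simp: mult_le_cancel_left dual_order.strict_iff_order)
  qed
  then show ?thesis
    unfolding bounded_op_def
    by (auto simp: hadjoint_mem intro!: hadjoint_eqI)
      (auto simp: hadjoint_mem ip_hadjoint_right X.ip_add X.ip_scale Y.ip_add Y.ip_scale bounded_op_mem[OF T])
qed

lemma hadjoint_hadjoint: "x \<in> carrier X \<Longrightarrow> hadjoint Y X (hadjoint X Y T) x = T x"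
  unfolding hadjoint_def[of Y X]
  by (rule the_equality)
    (auto simp: ip_hadjoint_left bounded_op_mem[OF T] intro!: Y.ip_ext)

end

lemma bounded_op_id: "bounded_op X X (\<lambda>x. x)"
  unfolding bounded_op_def by (auto intro!: exI[of _ 1])

lemma bounded_op_comp:
  assumes "hilbert_space Y" "bounded_op X Y S" "bounded_op Y Z T"
  shows "bounded_op X Z (\<lambda>x. T (S x))"
proof -
  obtain D where D: "\<And>x. x \<in> carrier X \<Longrightarrow> hnorm Y (S x) \<le> D * hnorm X x"
    using assms(2) unfolding bounded_op_def by blast
  obtain C where C: "0 \<le> C" "\<And>x. x \<in> carrier Y \<Longrightarrow> hnorm Z (T x) \<le> C * hnorm Y x"
    using bounded_op_bound[OF assms(1,3)] by blast
  have "hnorm Z (T (S x)) \<le> (C * D) * hnorm X x" if "x \<in> carrier X" for x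
  proof -
    have "hnorm Z (T (S x)) \<le> C * hnorm Y (S x)" using C that bounded_op_mem[OF assms(2)] by simp
    also have "\<dots> \<le> C * (D * hnorm X x)" using C(1) D[OF that] by (simp add: mult_left_mono)
    finally show ?thesis by (simp add: mult_ac)
  qed
  then show ?thesis
    unfolding bounded_op_def
    by (auto simp: bounded_opD[OF assms(2)] bounded_opD[OF assms(3)])
qed

lemma hadjoint_comp:
  assumes "hilbert_space X" "hilbert_space Y" "hilbert_space Z" "bounded_op X Y S" "bounded_op Y Z T"
    and "z \<in> carrier Z"
  shows "hadjoint X Z (\<lambda>x. T (S x)) z = hadjoint X Y S (hadjoint Y Z T z)"
proof (rule hadjoint_eqI[OF assms(1,3) bounded_op_comp[OF assms(2,4,5)]])
  have z: "hadjoint Y Z T z \<in> carrier Y" using assms by (intro hadjoint_mem)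
  then show "hadjoint X Y S (hadjoint Y Z T z) \<in> carrier X" using assms by (intro hadjoint_mem)
  fix u
  assume u: "u \<in> carrier X"
  have "ip X u (hadjoint X Y S (hadjoint Y Z T z)) = ip Y (S u) (hadjoint Y Z T z)"
    by (rule ip_hadjoint_right[OF assms(1,2,4) z u])
  also have "\<dots> = ip Z (T (S u)) z"
    by (rule ip_hadjoint_right[OF assms(2,3,5,6) bounded_op_mem[OF assms(4) u]])
  finally show "ip X u (hadjoint X Y S (hadjoint Y Z T z)) = ip Z (T (S u)) z" .
qed

section \<open>Words in a tuple of operators\<close>

lemma word_op_Nil: "word_op T [] = (\<lambda>x. x)"
  and word_op_Cons: "word_op T (i # \<alpha>) = (\<lambda>x. T i (word_op T \<alpha> x))"
  and word_op_snoc: "word_op T (\<alpha> @ [i]) = (\<lambda>x. word_op T \<alpha> (T i x))"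
  by (auto simp: word_op_def fun_eq_iff)

lemma bounded_op_word_op:
  assumes "hilbert_space X" "\<And>i. bounded_op X X (T i)"
  shows "bounded_op X X (word_op T \<alpha>)"
proof (induction \<alpha>)
  case (Cons i \<alpha>)
  show ?case
    unfolding word_op_Cons by (rule bounded_op_comp[OF assms(1) Cons.IH assms(2)])
qed (simp add: word_op_Nil bounded_op_id)

lemma hadjoint_word_op_Nil:
  assumes "hilbert_space X" "x \<in> carrier X"
  shows "hadjoint X X (word_op T []) x = x"
  using assms by (intro hadjoint_eqI) (auto simp: word_op_Nil bounded_op_id)

text \<open>Adjoints reverse products, so a letter appended to the word acts last. Hence the
  inductions over words grow them at the right end, where \<open>shift_kernel\<close>
  appends.\<close>

lemma hadjoint_word_op_snoc:
  assumes "hilbert_space X" "\<And>i. bounded_op X X (T i)" "x \<in> carrier X"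
  shows "hadjoint X X (word_op T (\<alpha> @ [i])) x = hadjoint X X (T i) (hadjoint X X (word_op T \<alpha>) x)"
  unfolding word_op_snoc
  by (rule hadjoint_comp[OF assms(1,1,1,2) bounded_op_word_op[OF assms(1,2)] assms(3)])

text \<open>\<open>P f\<close> is the vector in the closed span of the \<open>e x\<close> that has
  the same inner products with them as f. These two properties determine it, so linearity,
  idempotence and the values of P are all instances of the uniqueness \<open>P_eq\<close>.\<close>

lemma orth_projection_exists:
  fixes e :: "'i \<Rightarrow> 'a::ab_group_add"
  assumes X: "hilbert_space X" and e: "\<And>x. e x \<in> carrier X"
  shows "\<exists>P. orth_projection X P \<and> (\<forall>x. P (e x) = e x) \<and>
    (\<forall>z\<in>carrier X. (\<forall>x. ip X (e x) z = 0) \<longrightarrow> P z = 0)"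
proof -
  interpret hilbert_space X by (rule X)
  let ?Q = "\<lambda>f g. g \<in> carrier X \<and> hnorm X g \<le> hnorm X f \<and> (\<forall>x. ip X (e x) g = ip X (e x) f) \<and>
    (\<forall>z\<in>carrier X. (\<forall>x. ip X (e x) z = 0) \<longrightarrow> ip X z g = 0)"
  define P where "P f = (SOME g. ?Q f g)" for f
  have P: "?Q f (P f)" if "f \<in> carrier X" for f
    unfolding P_def using gram_adjoint[where e = e and e' = e, OF X X e e refl that]
    by (intro someI_ex[of "?Q f"]) (simp only: Bex_def)
  have P_eq: "P f = g" if "f \<in> carrier X" "g \<in> carrier X" "\<And>x. ip X (e x) g = ip X (e x) f"
    "\<And>z. z \<in> carrier X \<Longrightarrow> (\<And>x. ip X (e x) z = 0) \<Longrightarrow> ip X z g = 0" for f g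
  proof -
    have [simp]: "P f \<in> carrier X" using P that by blast
    have "ip X (e x) (P f - g) = 0" for x using P[OF that(1)] that e by (simp add: ip_diff_right)
    \<comment> \<open>The difference is orthogonal to every \<open>e x\<close>, while
      \<open>P f\<close> and g both lie in the closed span of the \<open>e x\<close>.\<close>
    then have "ip X (P f - g) (P f) = 0" "ip X (P f - g) g = 0"
      using P[OF that(1)] that(2) by (auto intro: that(4))
    then have "ip X (P f - g) (P f - g) = 0" using that(2) by (simp add: ip_diff_right)
    then show ?thesis using that(2) by (simp add: ip_self_eq_zero)
  qed
  have bop: "bounded_op X X P"
    unfolding bounded_op_def
  proof (intro conjI ballI allI exI[of _ 1])
    fix f g a
    assume f: "f \<in> carrier X"
    show "P f \<in> carrier X" "hnorm X (P f) \<le> 1 * hnorm X f" using P[OF f] by auto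
    show "P (scale X a f) = scale X a (P f)"
      using P[OF f] f e by (intro P_eq) (auto simp: ip_scale)
    assume g: "g \<in> carrier X"
    show "P (f + g) = P f + P g"
      using P[OF f] P[OF g] f g e by (intro P_eq) (auto simp: ip_add)
  qed
  have orth: "ip X (P g) (f - P f) = 0" if "f \<in> carrier X" "g \<in> carrier X" for f g
  proof -
    have "ip X (f - P f) (P g) = 0"
      using P[OF that(1)] P[OF that(2)] that e by (simp add: ip_diff_right)
    then show ?thesis
      using P[OF that(1)] P[OF that(2)] that ip_cnj[of "f - P f" "P g"] by simp
  qed
  have "hadjoint X X P f = P f" if f: "f \<in> carrier X" for f
  proof (rule hadjoint_eqI[OF X X bop])
    show [simp]: "P f \<in> carrier X" using P[OF f] by blast
    fix u
    assume u: "u \<in> carrier X"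
    have [simp]: "P u \<in> carrier X" using P[OF u] by blast
    have "ip X (P u) f = ip X (P u) (P f)" using orth[OF f u] u f by (simp add: ip_diff_right)
    moreover have "ip X (P f) u = ip X (P f) (P u)" using orth[OF u f] u f by (simp add: ip_diff_right)
    ultimately show "ip X u (P f) = ip X (P u) f"
      using u f ip_cnj[of "P f" u] ip_cnj[of "P f" "P u"] by simp
  qed
  moreover have "P (P f) = P f" if "f \<in> carrier X" for f
    using P[OF that] by (intro P_eq) auto
  moreover have "P (e x) = e x" for x
  proof (rule P_eq)
    fix z assume "z \<in> carrier X" "\<And>x. ip X (e x) z = 0"
    then show "ip X z (e x) = 0" using ip_cnj[of "e x" z] e by simp
  qed (use e in auto)
  moreover have "P z = 0" if "z \<in> carrier X" "\<forall>x. ip X (e x) z = 0" for z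
    using that e by (intro P_eq) auto
  ultimately show ?thesis using bop unfolding orth_projection_def by blast
qed

section \<open>The Hilbert space of a positive definite kernel\<close>

definition pos_kernel :: "('i \<Rightarrow> 'i \<Rightarrow> complex) \<Rightarrow> bool" where
  "pos_kernel k \<longleftrightarrow> (\<forall>l. 0 \<le> kernel_form k l l)"

lemma kernel_form_append_left: "kernel_form k (l @ l') m = kernel_form k l m + kernel_form k l' m"
  and kernel_form_append_right: "kernel_form k l (m @ m') = kernel_form k l m + kernel_form k l m'"
  by (simp_all add: kernel_form_def split_def sum_list_addf)

lemma kernel_form_scale_left:
    "kernel_form k (map (map_prod ((*) a) id) l) m = cnj a * kernel_form k l m"
  and kernel_form_scale_right:
    "kernel_form k l (map (map_prod ((*) a) id) m) = a * kernel_form k l m"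
  by (simp_all add: kernel_form_def split_def sum_list_const_mult[symmetric] o_def mult_ac)

lemma kernel_form_diff: "kernel_form (\<lambda>x y. k x y - k' x y) l m = kernel_form k l m - kernel_form k' l m"
  by (simp add: kernel_form_def split_def right_diff_distrib sum_list_subtractf)

lemma kernel_form_sum:
  "kernel_form (\<lambda>x y. \<Sum>i\<in>I. k i x y) l m = (\<Sum>i\<in>I. kernel_form (k i) l m)"
proof (induction I rule: infinite_finite_induct)
  case (insert i I)
  then show ?case by (simp add: kernel_form_def split_def distrib_left sum_list_addf)
qed (simp_all add: kernel_form_def split_def)

lemma kernel_form_cong:
  assumes "\<And>a x b y. \<lbrakk>(a, x) \<in> set l; (b, y) \<in> set m\<rbrakk> \<Longrightarrow> k x y = k' x y"
  shows "kernel_form k l m = kernel_form k' l m"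
  unfolding kernel_form_def using assms by (auto intro!: arg_cong[of _ _ sum_list] map_cong)

text \<open>Positivity over complex combinations includes that every
  \<open>kernel_form k l l\<close> is real. Polarizing with l + m compares imaginary parts, and with
  l + \<i> m real parts.\<close>

lemma pos_kernel_hermitian:
  assumes "pos_kernel k"
  shows "kernel_form k m l = cnj (kernel_form k l m)"
proof -
  have real: "Im (kernel_form k l l) = 0" for l
    using assms by (simp add: pos_kernel_def less_eq_complex_def)
  have "Im (kernel_form k m l) = - Im (kernel_form k l m)"
    using real[of "l @ m"] real[of l] real[of m]
    by (simp add: kernel_form_append_left kernel_form_append_right)
  moreover have "Re (kernel_form k m l) = Re (kernel_form k l m)"
    using real[of "l @ map (map_prod ((*) \<i>) id) m"] real[of l] real[of m]
    by (simp add: kernel_form_append_left kernel_form_append_right kernel_form_scale_left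
        kernel_form_scale_right)
  ultimately show ?thesis by (simp add: complex_eq_iff)
qed

definition kernel_norm :: "('i \<Rightarrow> 'i \<Rightarrow> complex) \<Rightarrow> (complex \<times> 'i) list \<Rightarrow> real" where
  "kernel_norm k l = sqrt (Re (kernel_form k l l))"

lemma kernel_norm:
  assumes "pos_kernel k"
  shows kernel_norm_nonneg: "0 \<le> kernel_norm k l"
    and kernel_norm_square: "(kernel_norm k l)\<^sup>2 = Re (kernel_form k l l)"
    and kernel_form_self: "kernel_form k l l = of_real ((kernel_norm k l)\<^sup>2)"
  using assms by (auto simp: pos_kernel_def kernel_norm_def less_eq_complex_def complex_eq_iff)

lemma kernel_norm_add_square:
  assumes "pos_kernel k"
  shows "(kernel_norm k (l @ m))\<^sup>2 =
    (kernel_norm k l)\<^sup>2 + 2 * Re (kernel_form k l m) + (kernel_norm k m)\<^sup>2"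
  using pos_kernel_hermitian[OF assms, of m l]
  by (simp add: kernel_norm_square[OF assms] kernel_form_append_left kernel_form_append_right)

lemma kernel_norm_scale:
  assumes "pos_kernel k"
  shows "(kernel_norm k (map (map_prod ((*) a) id) l))\<^sup>2 = (cmod a)\<^sup>2 * (kernel_norm k l)\<^sup>2"
proof -
  have "kernel_form k (map (map_prod ((*) a) id) l) (map (map_prod ((*) a) id) l) =
      (a * cnj a) * kernel_form k l l"
    by (simp add: kernel_form_scale_left kernel_form_scale_right)
  also have "\<dots> = of_real ((cmod a)\<^sup>2 * (kernel_norm k l)\<^sup>2)"
    unfolding complex_norm_square[symmetric] kernel_form_self[OF assms] by simp
  finally show ?thesis unfolding kernel_norm_square[OF assms, of "map _ _"]
    by (simp only: Re_complex_of_real)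
qed

lemma kernel_cauchy_schwarz:
  assumes "pos_kernel k"
  shows "cmod (kernel_form k l m) \<le> kernel_norm k l * kernel_norm k m"
proof -
  have "cmod (kernel_form k l m) \<le> sqrt ((kernel_norm k l)\<^sup>2) * sqrt ((kernel_norm k m)\<^sup>2)"
  proof (rule quadratic_cauchy_schwarz)
    fix t
    have "0 \<le> (kernel_norm k (l @ map (map_prod ((*) t) id) m))\<^sup>2" by simp
    also have "\<dots> = (kernel_norm k l)\<^sup>2 + 2 * Re (t * kernel_form k l m)
        + (cmod t)\<^sup>2 * (kernel_norm k m)\<^sup>2"
      by (simp add: kernel_norm_add_square kernel_norm_scale kernel_form_scale_right assms)
    finally show "0 \<le> (kernel_norm k l)\<^sup>2 + 2 * Re (t * kernel_form k l m)
        + (cmod t)\<^sup>2 * (kernel_norm k m)\<^sup>2" .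
  qed auto
  then show ?thesis by (simp add: kernel_norm_nonneg assms)
qed

section \<open>Completion inside a Banach space of bounded functions\<close>

lemma bounded_in_bcontfun:
  fixes f :: "'i discrete \<Rightarrow> complex"
  assumes "\<And>x. cmod (f x) \<le> b"
  shows "f \<in> bcontfun"
  by (rule bcontfun_normI[OF _ assms]) (simp add: continuous_on_open_vimage open_discrete)

text \<open>Every bounded function on a discrete space is continuous, so
  \<open>'i discrete \<Rightarrow>\<^sub>C complex\<close> is the Banach space of all bounded
  functions with the supremum norm. Complex scalars act on it pointwise.\<close>

definition cscale :: "complex \<Rightarrow> ('i discrete \<Rightarrow>\<^sub>C complex) \<Rightarrow> ('i discrete \<Rightarrow>\<^sub>C complex)" where
  "cscale a f = Bcontfun (\<lambda>x. a * apply_bcontfun f x)"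

lemma apply_cscale [simp]: "apply_bcontfun (cscale a f) x = a * apply_bcontfun f x"
proof -
  have "(\<lambda>x. a * apply_bcontfun f x) \<in> bcontfun"
    by (rule bounded_in_bcontfun[where b = "cmod a * norm f"])
      (simp add: norm_mult mult_left_mono norm_bounded)
  then show ?thesis by (simp add: cscale_def Bcontfun_inverse)
qed

lemma vector_space_cscale: "vector_space cscale"
  by unfold_locales (auto intro!: bcontfun_eqI simp: algebra_simps)

lemma bounded_linear_cscale: "bounded_linear (cscale a)"
proof (rule bounded_linear_intro)
  show "norm (cscale a f) \<le> norm f * cmod a" for f :: "'i discrete \<Rightarrow>\<^sub>C complex"
    by (rule norm_bound) (simp add: norm_mult mult_right_mono norm_bounded mult.commute[of "cmod a"])
qed (auto intro!: bcontfun_eqI simp: algebra_simps)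

text \<open>Polarization of the supremum norm, with the sign that gives linearity in the second
  argument. It is norm continuous on the whole space, so the inner product laws pass from formal
  combinations to the closure of their image.\<close>

definition polar_ip :: "('i discrete \<Rightarrow>\<^sub>C complex) \<Rightarrow> ('i discrete \<Rightarrow>\<^sub>C complex) \<Rightarrow> complex" where
  "polar_ip f g = complex_of_real (((norm (f + g))\<^sup>2 - (norm (f - g))\<^sup>2) / 4) -
     \<i> * complex_of_real (((norm (f + cscale \<i> g))\<^sup>2 - (norm (f - cscale \<i> g))\<^sup>2) / 4)"

lemma polar_ip_tendsto:
  assumes "f \<longlonglongrightarrow> f'" "g \<longlonglongrightarrow> g'"
  shows "(\<lambda>n. polar_ip (f n) (g n)) \<longlonglongrightarrow> polar_ip f' g'"
  unfolding polar_ip_def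
  by (intro tendsto_intros assms bounded_linear.tendsto[OF bounded_linear_cscale]) auto

text \<open>
  The completion of the span of the formal symbols \<open>x\<close> with Gram matrix \<open>k\<close> is the closure of
  its image in its dual, which consists of bounded functions on formal combinations.
\<close>

lemma kernel_completion:
  fixes k :: "'i \<Rightarrow> 'i \<Rightarrow> complex"
  assumes k: "pos_kernel k"
  shows "\<exists>(Y :: ((complex \<times> 'i) list discrete \<Rightarrow>\<^sub>C complex) inner_space) e.
    hilbert_space Y \<and> (\<forall>x. e x \<in> carrier Y) \<and> (\<forall>x y. ip Y (e x) (e y) = k x y) \<and>
    (\<forall>f\<in>carrier Y. (\<forall>x. ip Y (e x) f = 0) \<longrightarrow> f = 0)"
proof -
  note kernel_norm_nonneg[OF k, simp]
  \<comment> \<open>\<open>J m\<close> evaluates the functional of m at normalized combinations; its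
    supremum norm is therefore the seminorm of m, attained at m itself. At null combinations
    division by zero gives 0, and there the numerator vanishes by Cauchy-Schwarz.\<close>
  define J where "J m = Bcontfun (\<lambda>l. kernel_form k (of_discrete l) m /
    of_real (kernel_norm k (of_discrete l)))" for m
  have bound: "cmod (kernel_form k l m / of_real (kernel_norm k l)) \<le> kernel_norm k m" for l m
    using kernel_cauchy_schwarz[OF k, of l m]
    by (cases "kernel_norm k l = 0") (auto simp: norm_divide divide_le_eq mult.commute less_le)
  have apply_J: "apply_bcontfun (J m) l = kernel_form k (of_discrete l) m /
      of_real (kernel_norm k (of_discrete l))" for m l
    unfolding J_def by (subst Bcontfun_inverse) (auto intro: bounded_in_bcontfun bound)
  have norm_J: "norm (J m) = kernel_norm k m" for m
  proof (rule antisym)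
    show "norm (J m) \<le> kernel_norm k m"
      by (rule norm_bound) (simp only: apply_J bound)
    have "kernel_norm k m = cmod (apply_bcontfun (J m) (discrete m))"
      by (simp add: apply_J discrete_inverse kernel_form_self[OF k] norm_divide norm_power power2_eq_square)
    also have "\<dots> \<le> norm (J m)" by (rule norm_bounded)
    finally show "kernel_norm k m \<le> norm (J m)" .
  qed
  have J_add: "J l + J m = J (l @ m)" for l m
    by (rule bcontfun_eqI) (simp add: apply_J kernel_form_append_right add_divide_distrib)
  have J_scale: "cscale a (J m) = J (map (map_prod ((*) a) id) m)" for a m
    by (rule bcontfun_eqI) (simp add: apply_J kernel_form_scale_right)
  have norm_add: "(norm (J l + cscale a (J m)))\<^sup>2 =
      (kernel_norm k l)\<^sup>2 + 2 * Re (a * kernel_form k l m) + (cmod a)\<^sup>2 * (kernel_norm k m)\<^sup>2" for a l m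
    unfolding J_scale J_add norm_J kernel_norm_add_square[OF k] kernel_norm_scale[OF k]
      kernel_form_scale_right ..
  have cscale_eq: "f + g = f + cscale 1 g" "f - g = f + cscale (- 1) g"
      "f - cscale \<i> g = f + cscale (- \<i>) g" for f g :: "(complex \<times> 'i) list discrete \<Rightarrow>\<^sub>C complex"
    by (auto intro!: bcontfun_eqI)
  have polar_J: "polar_ip (J l) (J m) = kernel_form k l m" for l m
    unfolding polar_ip_def cscale_eq(3) cscale_eq(1,2)[of "J l" "J m"] norm_add
    by (simp add: complex_eq_iff)
  define F where "F = closure (range J)"
  have F: "\<exists>l. (\<lambda>n::nat. J (l n)) \<longlonglongrightarrow> f" if f: "f \<in> F" for f
  proof -
    have "\<exists>s. (\<forall>n. s n \<in> range J) \<and> s \<longlonglongrightarrow> f"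
      using f by (simp only: F_def closure_sequential)
    then obtain s where s: "\<forall>n. s n \<in> range J" "s \<longlonglongrightarrow> f" by blast
    then have "s = (\<lambda>n. J (inv J (s n)))" by (simp add: f_inv_into_f)
    then show ?thesis using s(2) by metis
  qed
  have F_I: "f \<in> F" if "(\<lambda>n::nat. J (l n)) \<longlonglongrightarrow> f" for f l
    using that unfolding F_def closure_sequential by (auto intro!: exI[of _ "\<lambda>n. J (l n)"])
  have F_add: "f + g \<in> F" if f: "f \<in> F" and g: "g \<in> F" for f g
  proof -
    obtain l m where "(\<lambda>n::nat. J (l n)) \<longlonglongrightarrow> f" "(\<lambda>n::nat. J (m n)) \<longlonglongrightarrow> g"
      using F[OF f] F[OF g] by blast
    then have "(\<lambda>n::nat. J (l n @ m n)) \<longlonglongrightarrow> f + g"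
      unfolding J_add[symmetric] by (rule tendsto_add)
    then show ?thesis by (rule F_I)
  qed
  have F_scale: "cscale a f \<in> F" if f: "f \<in> F" for a f
  proof -
    obtain l where "(\<lambda>n::nat. J (l n)) \<longlonglongrightarrow> f" using F[OF f] by blast
    then have "(\<lambda>n::nat. J (map (map_prod ((*) a) id) (l n))) \<longlonglongrightarrow> cscale a f"
      unfolding J_scale[symmetric] by (rule bounded_linear.tendsto[OF bounded_linear_cscale])
    then show ?thesis by (rule F_I)
  qed
  have "J [] = 0" by (rule bcontfun_eqI) (simp add: apply_J kernel_form_def split_def)
  then have F_0: "0 \<in> F" unfolding F_def by (metis closure_subset range_eqI subsetD)
  \<comment> \<open>On the closure the polarized form returns the supremum norm, so completeness
    reduces to \<open>F\<close> being closed in a Banach space.\<close>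
  have polar_self: "polar_ip f f = of_real ((norm f)\<^sup>2)" if f: "f \<in> F" for f
  proof -
    obtain l where l: "(\<lambda>n::nat. J (l n)) \<longlonglongrightarrow> f" using F[OF f] by blast
    have "(\<lambda>n. polar_ip (J (l n)) (J (l n))) \<longlonglongrightarrow> complex_of_real ((norm f)\<^sup>2)"
      unfolding polar_J kernel_form_self[OF k] norm_J[symmetric] by (intro tendsto_intros l)
    with polar_ip_tendsto[OF l l] show ?thesis by (rule LIMSEQ_unique)
  qed
  define Y where "Y = \<lparr>carrier = F, scale = cscale, ip = polar_ip\<rparr>"
  have hnorm: "hnorm Y f = norm f" if "f \<in> F" for f
    using polar_self[OF that] by (simp add: hnorm_def Y_def del: of_real_power)
  interpret V: vector_space cscale by (rule vector_space_cscale)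
  have sub: "V.subspace F"
    using F_0 F_add F_scale by (rule V.subspaceI)
  have "hilbert_space Y"
  proof (rule hilbert_space.intro)
    show "module.subspace (scale Y) (carrier Y)" using sub by (simp add: Y_def)
  next
    fix f g h assume "f \<in> carrier Y" "g \<in> carrier Y" "h \<in> carrier Y"
    then obtain l m n where lim: "(\<lambda>i::nat. J (l i)) \<longlonglongrightarrow> f" "(\<lambda>i::nat. J (m i)) \<longlonglongrightarrow> g"
      "(\<lambda>i::nat. J (n i)) \<longlonglongrightarrow> h" unfolding Y_def by simp (metis F)
    have "(\<lambda>i. polar_ip (J (l i)) (J (m i) + J (n i))) \<longlonglongrightarrow> polar_ip f (g + h)"
      by (intro polar_ip_tendsto tendsto_add lim)
    moreover have "polar_ip (J (l i)) (J (m i) + J (n i)) =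
        polar_ip (J (l i)) (J (m i)) + polar_ip (J (l i)) (J (n i))" for i
      unfolding J_add polar_J by (rule kernel_form_append_right)
    moreover have "(\<lambda>i. polar_ip (J (l i)) (J (m i)) + polar_ip (J (l i)) (J (n i)))
        \<longlonglongrightarrow> polar_ip f g + polar_ip f h" by (intro polar_ip_tendsto tendsto_add lim)
    ultimately show "ip Y f (g + h) = ip Y f g + ip Y f h"
      unfolding Y_def by (auto intro: LIMSEQ_unique)
  next
    fix f g a assume "f \<in> carrier Y" "g \<in> carrier Y"
    then obtain l m where lim: "(\<lambda>i::nat. J (l i)) \<longlonglongrightarrow> f" "(\<lambda>i::nat. J (m i)) \<longlonglongrightarrow> g"
      unfolding Y_def by simp (metis F)
    note polar_lim = polar_ip_tendsto[OF lim]
    have "(\<lambda>i. polar_ip (J (l i)) (cscale a (J (m i)))) \<longlonglongrightarrow> polar_ip f (cscale a g)"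
      by (intro polar_ip_tendsto lim bounded_linear.tendsto[OF bounded_linear_cscale])
    moreover have "polar_ip (J (l i)) (cscale a (J (m i))) = a * polar_ip (J (l i)) (J (m i))" for i
      unfolding J_scale polar_J by (rule kernel_form_scale_right)
    ultimately show "ip Y f (scale Y a g) = a * ip Y f g"
      using tendsto_mult_left[OF polar_lim, of a] unfolding Y_def by (auto intro: LIMSEQ_unique)
    have "(\<lambda>i. polar_ip (J (m i)) (J (l i))) \<longlonglongrightarrow> polar_ip g f" by (intro polar_ip_tendsto lim)
    moreover have "polar_ip (J (m i)) (J (l i)) = cnj (polar_ip (J (l i)) (J (m i)))" for i
      unfolding polar_J by (rule pos_kernel_hermitian[OF k])
    ultimately show "ip Y g f = cnj (ip Y f g)"
      using tendsto_cnj[OF polar_lim] unfolding Y_def by (auto intro: LIMSEQ_unique)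
  next
    fix f assume "f \<in> carrier Y" "f \<noteq> 0"
    then show "0 < ip Y f f" using polar_self[of f] by (simp add: Y_def less_complex_def)
  next
    fix s :: "nat \<Rightarrow> _"
    assume s: "\<And>n. s n \<in> carrier Y"
      and cauchy: "\<And>e. e > 0 \<Longrightarrow> \<exists>N. \<forall>m\<ge>N. \<forall>n\<ge>N. hnorm Y (s m - s n) < e"
    have sF: "s n \<in> F" for n using s by (simp add: Y_def)
    have "Cauchy s"
      unfolding Cauchy_def dist_norm
      using cauchy hnorm[OF V.subspace_diff[OF sub sF sF]] by simp
    then obtain f where f: "s \<longlonglongrightarrow> f" by (meson Cauchy_convergent convergent_def)
    then have fF: "f \<in> F" using closed_sequentially[of F s f] sF by (simp add: F_def)
    have "(\<lambda>n. norm (s n - f)) \<longlonglongrightarrow> 0" using f by (simp add: LIM_zero tendsto_norm_zero)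
    then have "(\<lambda>n. hnorm Y (s n - f)) \<longlonglongrightarrow> 0"
      by (simp add: hnorm[OF V.subspace_diff[OF sub sF fF]])
    then show "\<exists>x\<in>carrier Y. (\<lambda>n. hnorm Y (s n - x)) \<longlonglongrightarrow> 0" using fF by (auto simp: Y_def)
  qed (simp add: Y_def vector_space_cscale)
  moreover define e where "e x = J [(1, x)]" for x
  have e: "e x \<in> carrier Y" for x
    using closure_subset[of "range J"] by (auto simp: Y_def F_def e_def)
  moreover have "ip Y (e x) (e y) = k x y" for x y
    by (simp add: Y_def e_def polar_J kernel_form_def)
  \<comment> \<open>f is a limit of combinations of the \<open>e x\<close>, all orthogonal to f, and
    so it is orthogonal to itself.\<close>
  moreover have "f = 0" if f: "f \<in> carrier Y" "\<And>x. ip Y (e x) f = 0" for f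
  proof -
    interpret Y: hilbert_space Y by fact
    have J_lincomb: "J l = lincomb Y e l" for l
    proof (induction l)
      case (Cons c l)
      obtain a x where c: "c = (a, x)" by fastforce
      have "J (c # l) = J [c] + J l" by (simp add: J_add)
      also have "J [c] = cscale a (e x)" by (simp add: c e_def J_scale)
      finally show ?case by (simp add: Cons c Y_def)
    qed (use \<open>J [] = 0\<close> in simp)
    have orth: "ip Y (J l) f = 0" for l
      unfolding J_lincomb by (simp add: Y.ip_lincomb_left e f split_def)
    obtain l where l: "(\<lambda>n::nat. J (l n)) \<longlonglongrightarrow> f" using F f(1) by (auto simp: Y_def)
    then have "(\<lambda>n. polar_ip (J (l n)) f) \<longlonglongrightarrow> polar_ip f f" by (intro polar_ip_tendsto) auto
    moreover have "polar_ip (J (l n)) f = 0" for n using orth[of "l n"] by (simp add: Y_def)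
    ultimately have "ip Y f f = 0" by (simp add: Y_def LIMSEQ_const_iff)
    then show ?thesis using f(1) by (simp add: Y.ip_self_eq_zero)
  qed
  ultimately show ?thesis by blast
qed

text \<open>A vector is determined by its inner products with a total family, so the coefficient map
  \<open>\<Phi>\<close> is injective and carries the Hilbert space structure to its image. This
  brings the completion down to functions on the index type.\<close>

lemma function_representation:
  fixes X :: "'a::ab_group_add inner_space" and e :: "'i \<Rightarrow> 'a"
  assumes X: "hilbert_space X" and e: "\<And>x. e x \<in> carrier X"
    and total: "\<And>f. \<lbrakk>f \<in> carrier X; \<And>x. ip X (e x) f = 0\<rbrakk> \<Longrightarrow> f = 0"
  shows "\<exists>(Y :: ('i \<Rightarrow> complex) inner_space) e'.
    hilbert_space Y \<and> (\<forall>x. e' x \<in> carrier Y) \<and> (\<forall>x y. ip Y (e' x) (e' y) = ip X (e x) (e y)) \<and>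
    (\<forall>f\<in>carrier Y. (\<forall>x. ip Y (e' x) f = 0) \<longrightarrow> f = 0)"
proof -
  interpret hilbert_space X by (rule X)
  define \<Phi> where "\<Phi> f x = ip X (e x) f" for f x
  have \<Phi>_add: "\<Phi> (f + g) = \<Phi> f + \<Phi> g" if "f \<in> carrier X" "g \<in> carrier X" for f g
    using that e by (auto simp: \<Phi>_def fun_eq_iff ip_add)
  have \<Phi>_diff: "\<Phi> (f - g) = \<Phi> f - \<Phi> g" if "f \<in> carrier X" "g \<in> carrier X" for f g
    using that e by (auto simp: \<Phi>_def fun_eq_iff ip_diff_right)
  have \<Phi>_scale: "\<Phi> (scale X a f) = (\<lambda>x. a * \<Phi> f x)" if "f \<in> carrier X" for f a
    using that e by (auto simp: \<Phi>_def fun_eq_iff ip_scale)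
  have \<Phi>_0: "\<Phi> 0 = 0" using e by (auto simp: \<Phi>_def fun_eq_iff)
  have "inj_on \<Phi> (carrier X)"
  proof (rule inj_onI)
    fix f g assume fg: "f \<in> carrier X" "g \<in> carrier X" "\<Phi> f = \<Phi> g"
    then have "f - g = 0" by (intro total) (auto simp: \<Phi>_def fun_eq_iff ip_diff_right e)
    then show "f = g" by simp
  qed
  then have inv: "inv_into (carrier X) \<Phi> (\<Phi> f) = f" if "f \<in> carrier X" for f
    using that by (rule inv_into_f_f)
  define Y where "Y = \<lparr>carrier = \<Phi> ` carrier X, scale = (\<lambda>a f x. a * f x),
    ip = (\<lambda>f g. ip X (inv_into (carrier X) \<Phi> f) (inv_into (carrier X) \<Phi> g))\<rparr>"
  have ip_Y: "ip Y (\<Phi> f) (\<Phi> g) = ip X f g" if "f \<in> carrier X" "g \<in> carrier X" for f g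
    using that by (simp add: Y_def inv)
  then have hnorm_Y: "hnorm Y (\<Phi> f) = hnorm X f" if "f \<in> carrier X" for f
    using that by (simp add: hnorm_def)
  have vs: "vector_space (scale Y)"
    by unfold_locales (auto simp: Y_def fun_eq_iff algebra_simps)
  have carrier_Y: "carrier Y = \<Phi> ` carrier X" by (simp add: Y_def)
  have scale_Y: "scale Y a (\<Phi> f) = \<Phi> (scale X a f)" if "f \<in> carrier X" for a f
    using that by (simp add: \<Phi>_scale) (simp add: Y_def)
  have Y: "hilbert_space Y"
  proof (rule hilbert_space.intro)
    interpret V: vector_space "scale Y" by (rule vs)
    show "V.subspace (carrier Y)"
      by (rule V.subspaceI)
        (auto simp: carrier_Y scale_Y \<Phi>_add[symmetric] intro!: image_eqI[of 0 \<Phi> 0] \<Phi>_0[symmetric])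
    show "\<exists>x\<in>carrier Y. (\<lambda>n. hnorm Y (s n - x)) \<longlonglongrightarrow> 0"
      if s: "\<And>n::nat. s n \<in> carrier Y"
        and cauchy: "\<And>e. e > 0 \<Longrightarrow> \<exists>N. \<forall>m\<ge>N. \<forall>n\<ge>N. hnorm Y (s m - s n) < e" for s
    proof -
      have "\<forall>n. \<exists>t. t \<in> carrier X \<and> s n = \<Phi> t" using s by (auto simp: carrier_Y)
      then obtain t where t: "\<And>n. t n \<in> carrier X" "\<And>n. s n = \<Phi> (t n)" by metis
      have "\<exists>x\<in>carrier X. (\<lambda>n. hnorm X (t n - x)) \<longlonglongrightarrow> 0"
        using cauchy by (intro complete) (auto simp: t \<Phi>_diff[symmetric] hnorm_Y)
      then obtain x where "x \<in> carrier X" "(\<lambda>n. hnorm X (t n - x)) \<longlonglongrightarrow> 0" by blast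
      then show ?thesis
        by (intro bexI[of _ "\<Phi> x"]) (auto simp: carrier_Y t \<Phi>_diff[symmetric] hnorm_Y)
    qed
    show "0 < ip Y f f" if f: "f \<in> carrier Y" "f \<noteq> 0" for f
    proof -
      obtain g where g: "g \<in> carrier X" "f = \<Phi> g" using f(1) unfolding carrier_Y by blast
      then have "g \<noteq> 0" using f(2) \<Phi>_0 by auto
      then show ?thesis using g by (simp add: ip_Y ip_pos)
    qed
  qed (auto simp: vs carrier_Y scale_Y ip_Y \<Phi>_add[symmetric] ip_add ip_scale intro: ip_cnj)
  moreover have "f = 0" if f: "f \<in> carrier Y" "\<And>x. ip Y (\<Phi> (e x)) f = 0" for f
  proof -
    obtain g where g: "g \<in> carrier X" "f = \<Phi> g" using f(1) unfolding carrier_Y by blast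
    then have "g = 0" using f(2) e by (intro total) (auto simp: ip_Y)
    then show ?thesis using g \<Phi>_0 by simp
  qed
  ultimately show ?thesis
    by (intro exI[of _ Y] exI[of _ "\<lambda>x. \<Phi> (e x)"]) (auto simp: ip_Y e carrier_Y)
qed

text \<open>The element type is prescribed by \<open>'j\<close> while the kernel is indexed by
  \<open>'i\<close>. Pulling k back along c only repeats generators and does not change the space
  they span.\<close>

lemma kernel_hilbert_space:
  fixes k :: "'i \<Rightarrow> 'i \<Rightarrow> complex" and c :: "'j \<Rightarrow> 'i"
  assumes k: "pos_kernel k" and c: "surj c"
  shows "\<exists>(Y :: ('j \<Rightarrow> complex) inner_space) e.
    hilbert_space Y \<and> (\<forall>x. e x \<in> carrier Y) \<and> (\<forall>x y. ip Y (e x) (e y) = k x y) \<and>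
    (\<forall>f\<in>carrier Y. (\<forall>x. ip Y (e x) f = 0) \<longrightarrow> f = 0)"
proof -
  define k' where "k' x y = k (c x) (c y)" for x y
  have "kernel_form k' l m = kernel_form k (map (map_prod id c) l) (map (map_prod id c) m)" for l m
    by (simp add: kernel_form_def k'_def split_def o_def)
  then have "pos_kernel k'" using k by (simp add: pos_kernel_def)
  then obtain Z :: "((complex \<times> 'j) list discrete \<Rightarrow>\<^sub>C complex) inner_space" and z
    where "hilbert_space Z" "\<And>x. z x \<in> carrier Z" "\<And>x y. ip Z (z x) (z y) = k' x y"
      "\<And>f. f \<in> carrier Z \<Longrightarrow> (\<And>x. ip Z (z x) f = 0) \<Longrightarrow> f = 0"
    using kernel_completion by metis
  then obtain Y :: "('j \<Rightarrow> complex) inner_space" and d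
    where Y: "hilbert_space Y" "\<And>x. d x \<in> carrier Y" "\<And>x y. ip Y (d x) (d y) = k' x y"
      "\<And>f. f \<in> carrier Y \<Longrightarrow> (\<And>x. ip Y (d x) f = 0) \<Longrightarrow> f = 0"
    using function_representation[of Z z] by auto metis
  interpret hilbert_space Y by fact
  \<comment> \<open>Indices with the same image under c have the same Gram entries, so the
    difference of their generators is orthogonal to all generators.\<close>
  have d: "d x = d (inv c (c x))" for x
  proof -
    have "d x - d (inv c (c x)) = 0"
      by (rule Y(4)) (simp_all add: Y ip_diff_right k'_def surj_f_inv_f[OF c])
    then show ?thesis by simp
  qed
  show ?thesis
  proof (intro exI[of _ Y] exI[of _ "\<lambda>x. d (inv c x)"] conjI allI ballI impI)
    fix f assume f: "f \<in> carrier Y" "\<forall>x. ip Y (d (inv c x)) f = 0"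
    have "ip Y (d x) f = 0" for x
      using f(2) by (subst d) blast
    then show "f = 0" using Y(4) f(1) by blast
  qed (simp_all add: Y k'_def surj_f_inv_f[OF c])
qed

section \<open>Cuntz dilation of a column contraction\<close>

text \<open>The Gram matrix that \<open>S_i^* S_j = \<delta>_ij\<close> and
  \<open>S_j^* x = T_j x\<close> force on the vectors \<open>S\<^sup>\<gamma> x\<close>. The index
  \<open>(\<gamma>, x)\<close> stands for such a vector and the list \<open>T j x\<close> for the
  sum of its entries. Equal first letters cancel; a letter facing an empty word crosses over as
  \<open>T_j\<close>.\<close>

function cuntz_kernel ::
  "('d \<Rightarrow> 'j \<Rightarrow> 'j list) \<Rightarrow> ('j \<Rightarrow> 'j \<Rightarrow> complex) \<Rightarrow> 'd list \<times> 'j \<Rightarrow> 'd list \<times> 'j \<Rightarrow> complex" where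
  "cuntz_kernel T k ([], x) ([], y) = k x y"
| "cuntz_kernel T k (i # \<gamma>, x) (j # \<delta>, y) = (if i = j then cuntz_kernel T k (\<gamma>, x) (\<delta>, y) else 0)"
| "cuntz_kernel T k ([], x) (j # \<delta>, y) = (\<Sum>x'\<leftarrow>T j x. cuntz_kernel T k ([], x') (\<delta>, y))"
| "cuntz_kernel T k (i # \<gamma>, x) ([], y) = (\<Sum>y'\<leftarrow>T i y. cuntz_kernel T k (\<gamma>, x) ([], y'))"
  by pat_completeness auto
termination
  by (relation "Wellfounded.measure (\<lambda>(T, k, p, q). length (fst p) + length (fst q))") auto

definition prepend :: "'d \<Rightarrow> 'd list \<times> 'j \<Rightarrow> 'd list \<times> 'j" where
  "prepend i p = (i # fst p, snd p)"

text \<open>The image of a generator under \<open>S_i^*\<close>, the list being read as a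
  sum.\<close>

fun branch :: "('d \<Rightarrow> 'j \<Rightarrow> 'j list) \<Rightarrow> 'd \<Rightarrow> 'd list \<times> 'j \<Rightarrow> ('d list \<times> 'j) list" where
  "branch T i ([], x) = map (Pair []) (T i x)"
| "branch T i (j # \<gamma>, x) = (if i = j then [(\<gamma>, x)] else [])"

context
  fixes T :: "'d::finite \<Rightarrow> 'j \<Rightarrow> 'j list" and k :: "'j \<Rightarrow> 'j \<Rightarrow> complex"
  assumes column: "\<And>x y. (\<Sum>i\<in>UNIV. \<Sum>x'\<leftarrow>T i x. \<Sum>y'\<leftarrow>T i y. k x' y') = k x y"
begin

text \<open>This is the relation \<open>\<Sum>_i S_i S_i^* = I\<close> in Gram form. Two empty words
  are where \<open>column\<close> enters, the isometry of the column T; in the other cases at most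
  one i contributes and a recursion equation of \<open>cuntz_kernel\<close> remains.\<close>

lemma cuntz_kernel_branch:
  "cuntz_kernel T k p q =
    (\<Sum>i\<in>UNIV. \<Sum>p'\<leftarrow>branch T i p. \<Sum>q'\<leftarrow>branch T i q. cuntz_kernel T k p' q')"
proof -
  obtain \<gamma> x \<delta> y where pq: "p = (\<gamma>, x)" "q = (\<delta>, y)" by fastforce
  have if_list: "(\<Sum>p\<leftarrow>(if b then xs else []). f p) = (if b then (\<Sum>p\<leftarrow>xs. f p) else 0)"
    for b xs and f :: "_ \<Rightarrow> complex" by simp
  have sum_list_if: "(\<Sum>p\<leftarrow>xs. if b then f p else 0) = (if b then (\<Sum>p\<leftarrow>xs. f p) else 0)"
    for b xs and f :: "_ \<Rightarrow> complex" by simp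
  show ?thesis
  proof (cases \<gamma>; cases \<delta>)
    assume "\<gamma> = []" "\<delta> = []"
    then show ?thesis by (simp add: pq o_def column)
  next
    fix j \<delta>' assume "\<gamma> = []" "\<delta> = j # \<delta>'"
    then show ?thesis by (simp add: pq o_def if_list sum_list_if)
  next
    fix j \<gamma>' assume "\<gamma> = j # \<gamma>'" "\<delta> = []"
    then show ?thesis by (simp add: pq o_def if_list)
  next
    fix j \<gamma>' j' \<delta>' assume "\<gamma> = j # \<gamma>'" "\<delta> = j' # \<delta>'"
    then show ?thesis by (simp add: pq if_list)
  qed
qed

lemma cuntz_kernel_prepend:
  "cuntz_kernel T k (prepend i p) (prepend j q) = (if i = j then cuntz_kernel T k p q else 0)"
  by (cases p; cases q) (simp add: prepend_def)

lemma branch_prepend: "branch T i (prepend j p) = (if i = j then [p] else [])"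
  by (cases p) (simp add: prepend_def)

text \<open>The same relation read as an expansion of one generator, which a Hilbert space with this
  Gram matrix inherits as soon as its generators are total.\<close>

lemma cuntz_kernel_expand:
  "cuntz_kernel T k q p = (\<Sum>i\<in>UNIV. \<Sum>p'\<leftarrow>branch T i p. cuntz_kernel T k q (prepend i p'))"
proof -
  \<comment> \<open>\<open>S_i\<close> crosses to the left argument as \<open>S_i^*\<close>: in the
    branch sum only the index i survives.\<close>
  have "cuntz_kernel T k q (prepend i p') = (\<Sum>q'\<leftarrow>branch T i q. cuntz_kernel T k q' p')" for i p'
  proof -
    have "cuntz_kernel T k q (prepend i p') =
        (\<Sum>j\<in>UNIV. if j = i then \<Sum>q'\<leftarrow>branch T j q. cuntz_kernel T k q' p' else 0)"
      by (subst cuntz_kernel_branch, rule sum.cong[OF refl]) (simp add: branch_prepend)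
    then show ?thesis by simp
  qed
  moreover have "(\<Sum>p'\<leftarrow>xs. \<Sum>q'\<leftarrow>ys. cuntz_kernel T k q' p') =
      (\<Sum>q'\<leftarrow>ys. \<Sum>p'\<leftarrow>xs. cuntz_kernel T k q' p')" for xs ys
    by (induction xs) (simp_all add: sum_list_addf)
  ultimately show ?thesis by (subst cuntz_kernel_branch) simp
qed

definition branch_combination :: "'d \<Rightarrow> (complex \<times> 'd list \<times> 'j) list \<Rightarrow> (complex \<times> 'd list \<times> 'j) list"
  where "branch_combination i l = concat (map (\<lambda>(a, p). map (Pair a) (branch T i p)) l)"

lemma kernel_form_branch:
  "kernel_form (cuntz_kernel T k) l m =
    (\<Sum>i\<in>UNIV. kernel_form (cuntz_kernel T k) (branch_combination i l) (branch_combination i m))"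
proof -
  have single: "kernel_form (cuntz_kernel T k) [(a, p)] [(b, q)] =
      (\<Sum>i\<in>UNIV. kernel_form (cuntz_kernel T k) (map (Pair a) (branch T i p)) (map (Pair b) (branch T i q)))"
    for a b p q
  proof -
    have "kernel_form (cuntz_kernel T k) (map (Pair a) xs) (map (Pair b) ys) =
        cnj a * b * (\<Sum>p'\<leftarrow>xs. \<Sum>q'\<leftarrow>ys. cuntz_kernel T k p' q')" for xs ys
      by (simp add: kernel_form_def o_def sum_list_const_mult mult.assoc)
    then show ?thesis
      using cuntz_kernel_branch[of p q] by (simp add: sum_distrib_left[symmetric] kernel_form_def)
  qed
  have left: "kernel_form (cuntz_kernel T k) [(a, p)] m =
      (\<Sum>i\<in>UNIV. kernel_form (cuntz_kernel T k) (map (Pair a) (branch T i p)) (branch_combination i m))"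
    for a p m
  proof (induction m)
    case (Cons c m)
    obtain b q where "c = (b, q)" by (cases c)
    then show ?case
      using kernel_form_append_right[of "cuntz_kernel T k" "[(a, p)]" "[c]" m]
      by (simp add: Cons single kernel_form_append_right sum.distrib branch_combination_def)
  qed (simp add: kernel_form_def branch_combination_def split_def o_def)
  show ?thesis
  proof (induction l)
    case (Cons c l)
    obtain a p where "c = (a, p)" by (cases c)
    then show ?case
      using kernel_form_append_left[of "cuntz_kernel T k" "[c]" l m]
      by (simp add: Cons left kernel_form_append_left sum.distrib branch_combination_def[of _ "_ # _"])
        (simp add: branch_combination_def)
  qed (simp add: kernel_form_def branch_combination_def)
qed

text \<open>Applying the \<open>S_i^*\<close> shortens every nonempty word by a letter and keeps
  empty words empty, while \<open>kernel_form_branch\<close> preserves the total form. After as many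
  rounds as the longest word has letters, only forms of k are left.\<close>

lemma pos_cuntz_kernel:
  assumes "pos_kernel k"
  shows "pos_kernel (cuntz_kernel T k)"
proof -
  have "0 \<le> kernel_form (cuntz_kernel T k) l l" if "\<forall>(a, p)\<in>set l. length (fst p) \<le> n" for n l
    using that
  proof (induction n arbitrary: l)
    case 0
    then have "\<forall>c\<in>set l. fst (snd c) = []" by auto
    then have "l = map (map_prod id (Pair [])) (map (map_prod id snd) l)"
      by (induction l) auto
    then obtain l' where "l = map (map_prod id (Pair [])) l'" by blast
    then have "kernel_form (cuntz_kernel T k) l l = kernel_form k l' l'"
      by (simp add: kernel_form_def split_def o_def)
    then show ?case using assms by (simp add: pos_kernel_def)
  next
    case (Suc n)
    have "\<forall>(a, p)\<in>set (branch_combination i l). length (fst p) \<le> n" for i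
    proof -
      have "length (fst p') \<le> n" if "p' \<in> set (branch T i p)" "length (fst p) \<le> Suc n" for p p'
        using that by (cases "(T, i, p)" rule: branch.cases) (auto split: if_splits)
      then show ?thesis using Suc.prems by (fastforce simp: branch_combination_def)
    qed
    then show ?case by (subst kernel_form_branch) (intro sum_nonneg Suc.IH)
  qed
  moreover have "\<exists>n. \<forall>(a, p)\<in>set l. length (fst p) \<le> n" for l :: "(complex \<times> 'd list \<times> 'j) list"
    by (rule exI[of _ "sum_list (map (\<lambda>(a, p). length (fst p)) l)"])
      (auto intro!: member_le_sum_list rev_image_eqI)
  ultimately show ?thesis unfolding pos_kernel_def by blast
qed

end

text \<open>
  The defect \<open>K - K\<^sub>\<Sigma>\<close> of the column contraction \<open>\<sigma>\<close> is stored at level \<open>1\<close> and then moved up one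
  level at a time by the generator \<open>i\<^sub>0\<close>; this turns the contraction into an isometry.
\<close>

definition defect_kernel ::
  "('x \<Rightarrow> 'x \<Rightarrow> complex) \<Rightarrow> ('x \<Rightarrow> 'x \<Rightarrow> complex) \<Rightarrow> nat \<times> 'x \<Rightarrow> nat \<times> 'x \<Rightarrow> complex" where
  "defect_kernel K D p q =
    (if fst p = fst q then (if fst p = 0 then K else D) (snd p) (snd q) else 0)"

definition defect_shift :: "('d \<Rightarrow> 'x \<Rightarrow> 'x) \<Rightarrow> 'd \<Rightarrow> 'd \<Rightarrow> nat \<times> 'x \<Rightarrow> (nat \<times> 'x) list" where
  "defect_shift \<sigma> i0 i p = (if fst p = 0 then [(0, \<sigma> i (snd p))] else []) @
    (if i = i0 then [(Suc (fst p), snd p)] else [])"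

text \<open>Images of level 0 contribute \<open>K_\<Sigma>\<close> at level 0 and D at level 1,
  which add up to K. Level n \<ge> 1 moves isometrically to n + 1 \<ge> 2 and so stays orthogonal to
  the images of level 0; this is what the growing levels are for.\<close>

lemma defect_column:
  fixes \<sigma> :: "'d::finite \<Rightarrow> 'x \<Rightarrow> 'x"
  assumes D: "\<And>x y. D x y = K x y - (\<Sum>i\<in>UNIV. K (\<sigma> i x) (\<sigma> i y))"
  shows "(\<Sum>i\<in>UNIV. \<Sum>p'\<leftarrow>defect_shift \<sigma> i0 i p. \<Sum>q'\<leftarrow>defect_shift \<sigma> i0 i q. defect_kernel K D p' q')
    = defect_kernel K D p q"
proof -
  have "(\<Sum>p'\<leftarrow>defect_shift \<sigma> i0 i p. \<Sum>q'\<leftarrow>defect_shift \<sigma> i0 i q. defect_kernel K D p' q') =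
      (if fst p = 0 \<and> fst q = 0 then K (\<sigma> i (snd p)) (\<sigma> i (snd q)) else 0) +
      (if i = i0 then (if fst p = fst q then D (snd p) (snd q) else 0) else 0)" for i
    by (auto simp: defect_shift_def defect_kernel_def)
  then have "(\<Sum>i\<in>UNIV. \<Sum>p'\<leftarrow>defect_shift \<sigma> i0 i p. \<Sum>q'\<leftarrow>defect_shift \<sigma> i0 i q. defect_kernel K D p' q') =
      (if fst p = 0 \<and> fst q = 0 then (\<Sum>i\<in>UNIV. K (\<sigma> i (snd p)) (\<sigma> i (snd q))) else 0) +
      (if fst p = fst q then D (snd p) (snd q) else 0)"
    by (simp add: sum.distrib)
  also have "\<dots> = defect_kernel K D p q" by (auto simp: defect_kernel_def D)
  finally show ?thesis .
qed

text \<open>The kernel is block diagonal over the levels: all entries at the level of the first one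
  split off, contribute a form of K or of D, and leave a shorter list.\<close>

lemma pos_defect_kernel:
  assumes "pos_kernel K" "pos_kernel D"
  shows "pos_kernel (defect_kernel K D)"
  unfolding pos_kernel_def
proof
  fix l :: "(complex \<times> nat \<times> 'a) list"
  show "0 \<le> kernel_form (defect_kernel K D) l l"
  proof (induction l rule: length_induct)
    case (1 l)
    show ?case
    proof (cases l)
      case (Cons c l')
      define n where "n = fst (snd c)"
      let ?k = "defect_kernel K D" and ?in = "\<lambda>c. fst (snd c) = n"
      define l1 where "l1 = filter ?in l"
      define l2 where "l2 = filter (\<lambda>c. \<not> ?in c) l"
      have split_sum: "(\<Sum>c\<leftarrow>l. f c) = (\<Sum>c\<leftarrow>l1. f c) + (\<Sum>c\<leftarrow>l2. f c)" for f :: "_ \<Rightarrow> complex"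
        unfolding l1_def l2_def by (induction l) (auto simp: add_ac)
      have zero: "kernel_form (\<lambda>p q. 0) xs ys = 0" for xs ys :: "(complex \<times> nat \<times> 'a) list"
        by (simp add: kernel_form_def split_def)
      have "kernel_form ?k l1 l2 = kernel_form (\<lambda>p q. 0) l1 l2"
        "kernel_form ?k l2 l1 = kernel_form (\<lambda>p q. 0) l2 l1"
        unfolding l1_def l2_def by (rule kernel_form_cong; auto simp: defect_kernel_def)+
      moreover have "kernel_form ?k l l =
          kernel_form ?k l1 l1 + kernel_form ?k l1 l2 + (kernel_form ?k l2 l1 + kernel_form ?k l2 l2)"
        unfolding kernel_form_def split_def by (simp add: split_sum sum_list_addf)
      moreover have "0 \<le> kernel_form ?k l2 l2"
      proof -
        have "length l2 < length l" unfolding l2_def Cons n_def by (simp add: le_imp_less_Suc)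
        then show ?thesis using 1 by blast
      qed
      moreover have "kernel_form ?k l1 l1 =
          kernel_form (if n = 0 then K else D) (map (map_prod id snd) l1) (map (map_prod id snd) l1)"
      proof -
        have "kernel_form ?k l1 l1 =
            kernel_form (\<lambda>p q. (if n = 0 then K else D) (snd p) (snd q)) l1 l1"
          unfolding l1_def by (rule kernel_form_cong) (auto simp: defect_kernel_def)
        then show ?thesis by (simp add: kernel_form_def split_def o_def)
      qed
      moreover have "0 \<le> kernel_form (if n = 0 then K else D) (map (map_prod id snd) l1) (map (map_prod id snd) l1)"
        using assms by (auto simp: pos_kernel_def)
      ultimately show ?thesis by (simp add: zero)
    qed (simp add: kernel_form_def)
  qed
qed

text \<open>E collects the error vectors: modulo E, \<open>S_i^*\<close> acts on the
  \<open>v x\<close> as \<open>\<sigma> i\<close>. In the proof E consists of the finite sums of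
  generators with empty word and positive level.\<close>

lemma cuntz_dilation_on:
  fixes K :: "'x \<Rightarrow> 'x \<Rightarrow> complex" and \<sigma> :: "'d::finite \<Rightarrow> 'x \<Rightarrow> 'x"
    and Y :: "'b::ab_group_add inner_space" and e :: "'d list \<times> nat \<times> 'x \<Rightarrow> 'b"
  defines "D \<equiv> \<lambda>x y. K x y - (\<Sum>i\<in>UNIV. K (\<sigma> i x) (\<sigma> i y))"
  assumes Y: "hilbert_space Y" and e [simp]: "\<And>p. e p \<in> carrier Y"
    and gram: "\<And>p q. ip Y (e p) (e q) =
      cuntz_kernel (defect_shift \<sigma> i0) (defect_kernel K D) p q"
    and total: "\<And>f. \<lbrakk>f \<in> carrier Y; \<And>p. ip Y (e p) f = 0\<rbrakk> \<Longrightarrow> f = 0"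
  shows "\<exists>S P v E. cuntz_family Y S \<and> orth_projection Y P \<and>
    (\<forall>x. v x \<in> carrier Y \<and> P (v x) = v x) \<and> (\<forall>x y. ip Y (v x) (v y) = K x y) \<and>
    (\<forall>g\<in>E. g \<in> carrier Y \<and> P g = 0 \<and> (\<forall>i. hadjoint Y Y (S i) g \<in> E)) \<and>
    0 \<in> E \<and> (\<forall>g\<in>E. \<forall>h\<in>E. g + h \<in> E) \<and>
    (\<forall>i x. hadjoint Y Y (S i) (v x) - v (\<sigma> i x) \<in> E)"
proof -
  let ?T = "defect_shift \<sigma> i0"
  define k0 where "k0 = defect_kernel K D"
  define k where "k = cuntz_kernel ?T k0"
  have column: "(\<Sum>i\<in>UNIV. \<Sum>p'\<leftarrow>?T i p. \<Sum>q'\<leftarrow>?T i q. k0 p' q') = k0 p q" for p q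
    unfolding k0_def by (rule defect_column) (simp add: D_def)
  have ip_e: "ip Y (e p) (e q) = k p q" for p q
    by (simp add: gram k_def k0_def)
  interpret hilbert_space Y by (rule Y)
  have ext: "f = g" if "f \<in> carrier Y" "g \<in> carrier Y" "\<And>p. ip Y (e p) f = ip Y (e p) g" for f g
    using total[of "f - g"] that by (simp add: ip_diff_right)
  \<comment> \<open>\<open>R i\<close> is the future \<open>S_i^*\<close>. Prepending i preserves
    Gram entries, so \<open>gram_adjoint\<close> produces \<open>R i\<close> on all of Y;
    \<open>S i\<close> is then defined as its adjoint.\<close>
  let ?Q = "\<lambda>i f g. g \<in> carrier Y \<and> hnorm Y g \<le> hnorm Y f \<and>
    (\<forall>p. ip Y (e p) g = ip Y (e (prepend i p)) f)"
  define R where "R i f = (SOME g. ?Q i f g)" for i f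
  have R_spec: "?Q i f (R i f)" if "f \<in> carrier Y" for i f
  proof -
    have ex: "\<exists>g. ?Q i f g"
      using gram_adjoint[OF Y Y, of e "\<lambda>p. e (prepend i p)" f] that
      by (auto simp: ip_e k_def cuntz_kernel_prepend[OF column])
    show ?thesis unfolding R_def by (rule someI_ex[OF ex])
  qed
  then have R [simp]: "R i f \<in> carrier Y"
    and R_norm: "hnorm Y (R i f) \<le> hnorm Y f"
    and ip_R: "ip Y (e p) (R i f) = ip Y (e (prepend i p)) f" if "f \<in> carrier Y" for i f p
    using that by blast+
  have bop: "bounded_op Y Y (R i)" for i
    unfolding bounded_op_def
    by (auto intro!: ext exI[of _ 1] simp: ip_R ip_add ip_scale R_norm)
  define S where "S i = hadjoint Y Y (R i)" for i
  have S_bop: "bounded_op Y Y (S i)" for i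
    unfolding S_def by (rule bounded_op_hadjoint[OF Y Y bop])
  have S_mem [simp]: "S i f \<in> carrier Y" if "f \<in> carrier Y" for i f
    using bounded_op_mem[OF S_bop that] .
  have S_adj: "hadjoint Y Y (S i) f = R i f" if "f \<in> carrier Y" for i f
    unfolding S_def by (rule hadjoint_hadjoint[OF Y Y bop that])
  have ip_S: "ip Y g (S i f) = ip Y (R i g) f" if "f \<in> carrier Y" "g \<in> carrier Y" for f g i
    unfolding S_def by (rule ip_hadjoint_right[OF Y Y bop that])
  have R_e: "R i (e (prepend j p)) = (if i = j then e p else 0)" for i j p
    by (rule ext) (auto simp: ip_R ip_e k_def cuntz_kernel_prepend[OF column])
  have S_e: "S i (e p) = e (prepend i p)" for i p
  proof (rule ip_ext)
    fix u assume u: "u \<in> carrier Y"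
    have "ip Y (e p) (R i u) = ip Y (e (prepend i p)) u" using u by (rule ip_R)
    then show "ip Y u (S i (e p)) = ip Y u (e (prepend i p))"
      using u ip_cnj[of "e p" "R i u"] ip_cnj[of "e (prepend i p)" u] by (simp add: ip_S)
  qed auto
  have RS: "R i (S j f) = (if i = j then f else 0)" if "f \<in> carrier Y" for i j f
  proof (rule ext)
    show "ip Y (e p) (R i (S j f)) = ip Y (e p) (if i = j then f else 0)" for p
      using that by (auto simp: ip_R ip_S R_e)
  qed (use that in auto)
  have sum_list_mem: "(\<Sum>p\<leftarrow>ps. e p) \<in> carrier Y" for ps
    by (induction ps) auto
  have ip_sum_list: "ip Y f (\<Sum>p\<leftarrow>ps. e p) = (\<Sum>p\<leftarrow>ps. ip Y f (e p))" if "f \<in> carrier Y" for f ps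
    using that by (induction ps) (auto simp: ip_add sum_list_mem)
  have expand: "(\<Sum>i\<in>UNIV. \<Sum>p'\<leftarrow>branch ?T i p. e (prepend i p')) = e p" for p
  proof (rule ext)
    have mem: "(\<Sum>p'\<leftarrow>branch ?T i p. e (prepend i p')) \<in> carrier Y" for i
      using sum_list_mem[of "map (prepend i) (branch ?T i p)"] by (simp add: o_def)
    then show "(\<Sum>i\<in>UNIV. \<Sum>p'\<leftarrow>branch ?T i p. e (prepend i p')) \<in> carrier Y"
      by (intro sum_mem)
    show "ip Y (e q) (\<Sum>i\<in>UNIV. \<Sum>p'\<leftarrow>branch ?T i p. e (prepend i p')) = ip Y (e q) (e p)" for q
      using mem ip_sum_list[of "e q" "map (prepend _) (branch ?T _ p)"]
        cuntz_kernel_expand[OF column, of q p, folded k_def]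
      by (simp add: ip_sum_right o_def ip_e)
  qed auto
  have R_sum_list: "R i (\<Sum>p\<leftarrow>ps. e (q p)) = (\<Sum>p\<leftarrow>ps. R i (e (q p)))" for i ps and q :: "_ \<Rightarrow> _"
  proof (induction ps)
    case (Cons p ps)
    then show ?case
      using sum_list_mem[of "map q ps"] by (simp add: o_def bounded_op_add[OF bop])
  qed (simp add: bounded_op_zero[OF Y Y bop])
  have R_e_eq: "R i (e p) = (\<Sum>p'\<leftarrow>branch ?T i p. e p')" for i p
  proof -
    have mem: "(\<Sum>p'\<leftarrow>branch ?T j p. e (prepend j p')) \<in> carrier Y" for j
      using sum_list_mem[of "map (prepend j) (branch ?T j p)"] by (simp add: o_def)
    have "R i (e p) = R i (\<Sum>j\<in>UNIV. \<Sum>p'\<leftarrow>branch ?T j p. e (prepend j p'))" by (simp add: expand)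
    also have "\<dots> = (\<Sum>j\<in>UNIV. \<Sum>p'\<leftarrow>branch ?T j p. R i (e (prepend j p')))"
      using mem by (simp add: bounded_op_sum[OF Y Y bop] R_sum_list)
    also have "\<dots> = (\<Sum>j\<in>UNIV. if i = j then \<Sum>p'\<leftarrow>branch ?T j p. e p' else 0)"
      by (intro sum.cong) (auto simp: R_e)
    finally show ?thesis by simp
  qed
  \<comment> \<open>Tested against generators: \<open>R i (e p)\<close> is a branch sum,
    \<open>ip_R\<close> turns the other \<open>R i\<close> into a prepended i, and
    \<open>expand\<close> reassembles \<open>e p\<close>.\<close>
  have SR: "(\<Sum>i\<in>UNIV. S i (R i f)) = f" if f: "f \<in> carrier Y" for f
  proof (rule ext)
    show "(\<Sum>i\<in>UNIV. S i (R i f)) \<in> carrier Y" using f by (intro sum_mem) auto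
    fix p
    have mem: "(\<Sum>p'\<leftarrow>branch ?T j p. e (prepend j p')) \<in> carrier Y" for j
      using sum_list_mem[of "map (prepend j) (branch ?T j p)"] by (simp add: o_def)
    have left: "ip Y (\<Sum>p\<leftarrow>ps. e p) g = (\<Sum>p\<leftarrow>ps. ip Y (e p) g)" if "g \<in> carrier Y" for g ps
      using that by (induction ps) (auto simp: ip_add_left sum_list_mem)
    have "ip Y (e p) (\<Sum>i\<in>UNIV. S i (R i f)) = (\<Sum>i\<in>UNIV. ip Y (R i (e p)) (R i f))"
      using f by (simp add: ip_sum_right ip_S)
    also have "\<dots> = (\<Sum>i\<in>UNIV. \<Sum>p'\<leftarrow>branch ?T i p. ip Y (e (prepend i p')) f)"
      using f by (simp add: R_e_eq left ip_R)
    also have "\<dots> = ip Y (\<Sum>i\<in>UNIV. \<Sum>p'\<leftarrow>branch ?T i p. e (prepend i p')) f"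
      using f mem left[of f "map (prepend _) (branch ?T _ p)"] by (simp add: ip_sum_left o_def)
    also have "\<dots> = ip Y (e p) f" by (simp only: expand)
    finally show "ip Y (e p) (\<Sum>i\<in>UNIV. S i (R i f)) = ip Y (e p) f" .
  qed (use f in auto)
  have cuntz: "cuntz_family Y S"
    unfolding cuntz_family_def by (auto simp: S_bop S_adj RS SR)
  define v where "v x = e ([], 0, x)" for x
  have v_mem: "v x \<in> carrier Y" for x by (simp add: v_def)
  \<comment> \<open>The generators with empty word and level 0 span the Kolmogorov space of K; those
    at positive levels are orthogonal to it, whence \<open>P_z\<close>.\<close>
  obtain P where P: "orth_projection Y P" "\<And>x. P (v x) = v x"
    "\<And>z. z \<in> carrier Y \<Longrightarrow> (\<And>x. ip Y (v x) z = 0) \<Longrightarrow> P z = 0"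
    using orth_projection_exists[OF Y, of v] by (auto simp: v_def)
  have P_bop: "bounded_op Y Y P" using P(1) by (simp add: orth_projection_def)
  define z where "z ps = (\<Sum>p\<leftarrow>ps. e ([], Suc (fst p), snd p))" for ps :: "(nat \<times> 'x) list"
  have z_mem: "z ps \<in> carrier Y" for ps
    using sum_list_mem[of "map (\<lambda>p. ([], Suc (fst p), snd p)) ps"] by (simp add: z_def o_def)
  have P_z: "P (z ps) = 0" for ps
  proof (rule P(3)[OF z_mem])
    fix x
    have "ip Y (v x) (z ps) = (\<Sum>p\<leftarrow>ps. ip Y (v x) (e ([], Suc (fst p), snd p)))"
      using ip_sum_list[of "v x" "map (\<lambda>p. ([], Suc (fst p), snd p)) ps"]
      by (simp add: z_def o_def v_def)
    then show "ip Y (v x) (z ps) = 0"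
      by (simp add: v_def ip_e k_def k0_def defect_kernel_def)
  qed
  have R_z: "R i (z ps) \<in> range z" for i ps
  proof -
    \<comment> \<open>The generator \<open>i0\<close> raises every level by one; the others
      annihilate positive levels.\<close>
    have "R i (z ps) = z (if i = i0 then map (map_prod Suc id) ps else [])"
      unfolding z_def R_sum_list R_e_eq by (simp add: defect_shift_def o_def)
    then show ?thesis by simp
  qed
  have R_v: "R i (v x) - v (\<sigma> i x) = z (if i = i0 then [(0, x)] else [])" for i x
    by (simp add: v_def R_e_eq defect_shift_def z_def)
  have z_add: "z ps + z qs \<in> range z" for ps qs
    by (rule image_eqI[of _ _ "ps @ qs"]) (simp_all add: z_def)
  have z_0: "0 \<in> range z"
    by (rule image_eqI[of _ _ "[]"]) (simp_all add: z_def)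
  have ip_v: "ip Y (v x) (v y) = K x y" for x y
    by (simp add: v_def ip_e k_def k0_def defect_kernel_def)
  show ?thesis
    by (intro exI[of _ S] exI[of _ P] exI[of _ v] exI[of _ "range z"])
      (auto simp: cuntz P(1,2) ip_v z_mem P_z R_z S_adj z_0 z_add R_v v_mem)
qed

lemma cuntz_dilation:
  fixes K :: "'x \<Rightarrow> 'x \<Rightarrow> complex" and \<sigma> :: "'d::finite \<Rightarrow> 'x \<Rightarrow> 'x"
    and c :: "'j \<Rightarrow> 'd list \<times> nat \<times> 'x"
  assumes K: "pos_kernel K" and D: "pos_kernel (\<lambda>x y. K x y - (\<Sum>i\<in>UNIV. K (\<sigma> i x) (\<sigma> i y)))"
    and c: "surj c"
  shows "\<exists>(Y :: ('j \<Rightarrow> complex) inner_space) S P v E.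
    hilbert_space Y \<and> cuntz_family Y S \<and> orth_projection Y P \<and>
    (\<forall>x. v x \<in> carrier Y \<and> P (v x) = v x) \<and> (\<forall>x y. ip Y (v x) (v y) = K x y) \<and>
    (\<forall>g\<in>E. g \<in> carrier Y \<and> P g = 0 \<and> (\<forall>i. hadjoint Y Y (S i) g \<in> E)) \<and>
    0 \<in> E \<and> (\<forall>g\<in>E. \<forall>h\<in>E. g + h \<in> E) \<and>
    (\<forall>i x. hadjoint Y Y (S i) (v x) - v (\<sigma> i x) \<in> E)"
proof -
  \<comment> \<open>Any generator may carry the shift; one exists because types are nonempty, that
    is, d \<ge> 1.\<close>
  obtain i0 :: 'd where True by simp
  let ?k = "cuntz_kernel (defect_shift \<sigma> i0)
    (defect_kernel K (\<lambda>x y. K x y - (\<Sum>i\<in>UNIV. K (\<sigma> i x) (\<sigma> i y))))"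
  have "pos_kernel ?k"
    by (intro pos_cuntz_kernel pos_defect_kernel defect_column refl K D)
  from kernel_hilbert_space[OF this c] obtain Y :: "('j \<Rightarrow> complex) inner_space" and e
    where Y: "hilbert_space Y" "\<forall>p. e p \<in> carrier Y" "\<forall>p q. ip Y (e p) (e q) = ?k p q"
      "\<forall>f\<in>carrier Y. (\<forall>p. ip Y (e p) f = 0) \<longrightarrow> f = 0"
    by blast
  have "\<exists>S P v E. cuntz_family Y S \<and> orth_projection Y P \<and>
    (\<forall>x. v x \<in> carrier Y \<and> P (v x) = v x) \<and> (\<forall>x y. ip Y (v x) (v y) = K x y) \<and>
    (\<forall>g\<in>E. g \<in> carrier Y \<and> P g = 0 \<and> (\<forall>i. hadjoint Y Y (S i) g \<in> E)) \<and>
    0 \<in> E \<and> (\<forall>g\<in>E. \<forall>h\<in>E. g + h \<in> E) \<and>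
    (\<forall>i x. hadjoint Y Y (S i) (v x) - v (\<sigma> i x) \<in> E)"
    using Y by (intro cuntz_dilation_on[where e = e and ?i0.0 = i0]) blast+
  with Y(1) show ?thesis by blast
qed

section \<open>Cuntz representations of moment kernels\<close>

text \<open>The squared norm of \<open>W (x + y) - (W x + W y)\<close> expands into inner products
  and vanishes, so linearity comes for free. The lemma serves a map known only through its Gram
  matrix.\<close>

lemma isometryI:
  assumes X: "hilbert_space X" and Y: "hilbert_space Y"
    and W: "\<And>x. x \<in> carrier X \<Longrightarrow> W x \<in> carrier Y"
    and ip: "\<And>x y. \<lbrakk>x \<in> carrier X; y \<in> carrier X\<rbrakk> \<Longrightarrow> ip Y (W x) (W y) = ip X x y"
  shows "isometry X Y W"
proof -
  interpret X: hilbert_space X by (rule X)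
  interpret Y: hilbert_space Y by (rule Y)
  have norm: "hnorm Y (W x) = hnorm X x" if "x \<in> carrier X" for x
    using that by (simp add: hnorm_def ip)
  have "W (x + y) = W x + W y" if "x \<in> carrier X" "y \<in> carrier X" for x y
  proof -
    have "ip Y (W (x + y) - (W x + W y)) (W (x + y) - (W x + W y)) = 0"
      using that by (simp add: W ip Y.ip_add Y.ip_add_left Y.ip_diff_left Y.ip_diff_right
          X.ip_add X.ip_add_left)
    then show ?thesis using that by (subst (asm) Y.ip_self_eq_zero) (simp_all add: W)
  qed
  moreover have "W (scale X a x) = scale Y a (W x)" if "x \<in> carrier X" for a x
  proof -
    have "ip Y (W (scale X a x) - scale Y a (W x)) (W (scale X a x) - scale Y a (W x)) = 0"
      using that by (simp add: W ip Y.ip_scale Y.ip_scale_left Y.ip_diff_left Y.ip_diff_right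
          X.ip_scale X.ip_scale_left)
    then show ?thesis using that by (subst (asm) Y.ip_self_eq_zero) (simp_all add: W)
  qed
  moreover have "hnorm Y (W x) \<le> 1 * hnorm X x" if "x \<in> carrier X" for x
    using norm[OF that] by simp
  ultimately show ?thesis
    unfolding isometry_def bounded_op_def using W norm by blast
qed

lemma bounded_op_tendsto_hnorm:
  assumes X: "hilbert_space X" and Y: "hilbert_space Y" and T: "bounded_op X Y T"
    and s: "\<And>n::nat. s n \<in> carrier X" "x \<in> carrier X" "(\<lambda>n. hnorm X (s n - x)) \<longlonglongrightarrow> 0"
  shows "(\<lambda>n. hnorm Y (T (s n))) \<longlonglongrightarrow> hnorm Y (T x)"
proof -
  interpret X: hilbert_space X by (rule X)
  interpret Y: hilbert_space Y by (rule Y)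
  obtain C where C: "0 \<le> C" "\<And>x. x \<in> carrier X \<Longrightarrow> hnorm Y (T x) \<le> C * hnorm X x"
    using bounded_op_bound[OF X T] by blast
  have "(\<lambda>n. hnorm Y (T (s n) - T x)) \<longlonglongrightarrow> 0"
  proof (rule Lim_null_comparison)
    show "\<forall>\<^sub>F n in sequentially. norm (hnorm Y (T (s n) - T x)) \<le> C * hnorm X (s n - x)"
      using C(2) s by (simp add: bounded_op_diff[OF X Y T, symmetric] bounded_op_mem[OF T])
    show "(\<lambda>n. C * hnorm X (s n - x)) \<longlonglongrightarrow> 0"
      using tendsto_mult_left[OF s(3), of C] by simp
  qed
  then show ?thesis
    using s by (intro Y.hnorm_tendsto) (simp_all add: bounded_op_mem[OF T])
qed

context
  fixes X :: "'a::ab_group_add inner_space" and P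
  assumes X: "hilbert_space X" and P: "orth_projection X P"
begin

interpretation hilbert_space X by (rule X)

lemma bounded_op_projection: "bounded_op X X P"
  using P by (simp add: orth_projection_def)

lemma projection_mem: "x \<in> carrier X \<Longrightarrow> P x \<in> carrier X"
  by (rule bounded_op_mem[OF bounded_op_projection])

lemma ip_projection:
  assumes "x \<in> carrier X" "y \<in> carrier X"
  shows "ip X x (P y) = ip X (P x) (P y)"
proof -
  have "ip X x (hadjoint X X P (P y)) = ip X (P x) (P y)"
    using assms by (intro ip_hadjoint_right[OF X X bounded_op_projection]) (auto simp: projection_mem)
  then show ?thesis using P assms by (simp add: orth_projection_def projection_mem)
qed

lemma hnorm_projection_diff:
  assumes "x \<in> carrier X"
  shows "(hnorm X (x - P x))\<^sup>2 = (hnorm X x)\<^sup>2 - (hnorm X (P x))\<^sup>2"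
  using hnorm_add_square[of x "- P x"] assms
  by (simp add: projection_mem hnorm_uminus ip_uminus_right ip_projection ip_self)

lemma hnorm_projection_le: "x \<in> carrier X \<Longrightarrow> hnorm X (P x) \<le> hnorm X x"
proof (rule power2_le_imp_le)
  assume x: "x \<in> carrier X"
  show "(hnorm X (P x))\<^sup>2 \<le> (hnorm X x)\<^sup>2"
    using hnorm_projection_diff[OF x] zero_le_power2[of "hnorm X (x - P x)"] by linarith
qed simp

lemma projection_eqI:
  assumes "x \<in> carrier X" "(hnorm X (P x))\<^sup>2 = (hnorm X x)\<^sup>2"
  shows "P x = x"
proof -
  have "hnorm X (x - P x) = 0" using hnorm_projection_diff[of x] assms by simp
  then show ?thesis using assms by (simp add: projection_mem)
qed

text \<open>Turns the operator inequality of (1) into one between sums of squared norms, the form in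
  which it is both used and proved.\<close>

lemma ip_column:
  fixes S :: "'d::finite \<Rightarrow> 'a \<Rightarrow> 'a"
  assumes S: "\<And>i. bounded_op X X (S i)" and y: "y \<in> carrier X"
  shows "ip X y (\<Sum>i\<in>UNIV. S i (P (hadjoint X X (S i) y))) =
    of_real (\<Sum>i\<in>UNIV. (hnorm X (P (hadjoint X X (S i) y)))\<^sup>2)"
proof -
  have mem: "hadjoint X X (S i) y \<in> carrier X" for i by (rule hadjoint_mem[OF X X S y])
  have "ip X y (S i (P (hadjoint X X (S i) y))) = of_real ((hnorm X (P (hadjoint X X (S i) y)))\<^sup>2)" for i
    using ip_hadjoint_left[OF X X S y, of "P (hadjoint X X (S i) y)" i] mem[of i]
    by (simp add: projection_mem ip_projection ip_self)
  then show ?thesis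
    using mem y by (simp add: ip_sum_right projection_mem bounded_op_mem[OF S])
qed

end

lemma hadjoint_orbit_in_span:
  fixes \<alpha> :: "nat \<Rightarrow> 'd list"
  assumes Y: "hilbert_space Y" and S: "\<And>i. bounded_op Y Y (S i)"
    and W: "\<And>x. x \<in> carrier H \<Longrightarrow> W x \<in> carrier Y" and u: "\<And>j. j < N \<Longrightarrow> u j \<in> carrier H"
  shows "(\<Sum>j<N. hadjoint Y Y (word_op S (\<alpha> j)) (W (u j))) \<in> adjoint_orbit_span H Y S W"
proof -
  interpret hilbert_space Y by (rule Y)
  interpret V: vector_space "scale Y" by (rule vector_space)
  let ?B = "{hadjoint Y Y (word_op S \<gamma>) (W h) | \<gamma> h. h \<in> carrier H}"
  let ?z = "\<Sum>j<N. hadjoint Y Y (word_op S (\<alpha> j)) (W (u j))"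
  have "?z \<in> V.span ?B"
    using u by (intro V.span_sum V.span_base) blast
  moreover have "?z \<in> carrier Y"
    using u W by (intro sum_mem hadjoint_mem[OF Y Y] bounded_op_word_op[OF Y S]) auto
  ultimately show ?thesis
    unfolding adjoint_orbit_span_def closed_span_def
    by (auto intro!: exI[of _ "\<lambda>_. ?z"])
qed

section \<open>Kernel inequality and equality case for a given Cuntz representation\<close>

context
  fixes H :: "'a::ab_group_add inner_space" and K :: "('d::finite, 'a) kernel"
    and Y :: "'b::ab_group_add inner_space" and S P W
  assumes H: "hilbert_space H" and rep: "cuntz_representation H K Y S P W"
begin

interpretation H: hilbert_space H by (rule H)

lemma representation_Y: "hilbert_space Y"
  using rep by (simp add: cuntz_representation_def)

interpretation Y: hilbert_space Y by (rule representation_Y)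

lemma representation:
  shows representation_S: "bounded_op Y Y (S i)"
    and representation_P: "orth_projection Y P"
    and representation_W: "isometry H Y W" "bounded_op H Y W"
    and representation_K: "v \<in> carrier H \<Longrightarrow>
      K \<alpha> \<beta> v = hadjoint H Y W (word_op S \<alpha> (P (hadjoint Y Y (word_op S \<beta>) (W v))))"
    and representation_cuntz: "y \<in> carrier Y \<Longrightarrow> (\<Sum>i\<in>UNIV. S i (hadjoint Y Y (S i) y)) = y"
  using rep
  unfolding cuntz_representation_def cuntz_family_def isometry_def kernel_eq_def by blast+

abbreviation (input) "orbit \<alpha> u \<equiv> hadjoint Y Y (word_op S \<alpha>) (W u)"

lemma representation_W_mem: "u \<in> carrier H \<Longrightarrow> W u \<in> carrier Y"
  by (rule bounded_op_mem[OF representation_W(2)])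

lemma representation_word_op: "bounded_op Y Y (word_op S \<alpha>)"
  by (rule bounded_op_word_op[OF representation_Y representation_S])

lemma orbit_mem: "u \<in> carrier H \<Longrightarrow> orbit \<alpha> u \<in> carrier Y"
  by (rule hadjoint_mem[OF representation_Y representation_Y representation_word_op representation_W_mem])

lemma orbit_snoc: "u \<in> carrier H \<Longrightarrow> orbit (\<alpha> @ [i]) u = hadjoint Y Y (S i) (orbit \<alpha> u)"
  by (rule hadjoint_word_op_snoc[OF representation_Y representation_S representation_W_mem])

lemma ip_orbit:
  assumes "u \<in> carrier H" "y \<in> carrier Y"
  shows "ip H u (hadjoint H Y W (word_op S \<alpha> y)) = ip Y (orbit \<alpha> u) y"
proof -
  have "word_op S \<alpha> y \<in> carrier Y" using assms by (intro bounded_op_mem[OF representation_word_op])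
  then have "ip H u (hadjoint H Y W (word_op S \<alpha> y)) = ip Y (W u) (word_op S \<alpha> y)"
    using assms by (intro ip_hadjoint_right[OF H representation_Y representation_W(2)])
  also have "\<dots> = ip Y (orbit \<alpha> u) y"
    using assms by (intro ip_hadjoint_left[OF representation_Y representation_Y representation_word_op, symmetric] representation_W_mem)
  finally show ?thesis .
qed

text \<open>A projection can be put on both sides, so K is the Gram kernel of the projected orbit
  vectors.\<close>

lemma ip_representation:
  assumes "u \<in> carrier H" "v \<in> carrier H"
  shows "ip H u (K \<alpha> \<beta> v) = ip Y (P (orbit \<alpha> u)) (P (orbit \<beta> v))"
  using assms
  by (simp add: representation_K ip_orbit orbit_mem ip_projection[OF representation_Y representation_P]
      projection_mem[OF representation_Y representation_P])

lemma representation_K_mem: "v \<in> carrier H \<Longrightarrow> K \<alpha> \<beta> v \<in> carrier H"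
  unfolding representation_K
  by (intro hadjoint_mem[OF H representation_Y representation_W(2)] bounded_op_mem[OF representation_word_op]
      projection_mem[OF representation_Y representation_P] orbit_mem)

text \<open>Appending k to a word applies \<open>S_k^*\<close> to the orbit vector. The form of
  \<open>K - K_\<Sigma>\<close> is therefore the gap in the inequality of (1) at the sum z of the
  given orbit vectors, which lies in the subspace of (1).\<close>

lemma representation_kernel_le: "kernel_le H (shift_kernel K) K"
  unfolding kernel_le_def positive_definite_def
proof (intro allI impI)
  fix N :: nat and \<alpha> :: "nat \<Rightarrow> 'd list" and u
  assume "\<forall>j<N. u j \<in> carrier H"
  then have u: "u j \<in> carrier H" if "j < N" for j using that by blast
  define z where "z = (\<Sum>j<N. orbit (\<alpha> j) (u j))"
  have z: "z \<in> adjoint_orbit_span H Y S W" "z \<in> carrier Y"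
    unfolding z_def using u
    by (auto intro!: hadjoint_orbit_in_span representation_Y representation_S representation_W_mem Y.sum_mem orbit_mem)
  have P_bop: "bounded_op Y Y P"
    by (rule bounded_op_projection[OF representation_Y representation_P])
  have PR_bop: "bounded_op Y Y (\<lambda>y. P (hadjoint Y Y (S k) y))" for k
    by (rule bounded_op_comp[OF representation_Y bounded_op_hadjoint[OF representation_Y
          representation_Y representation_S] P_bop])
  \<comment> \<open>Used for \<open>T = P\<close> and for T the composite of P and
    \<open>S_k^*\<close>.\<close>
  have sum: "(\<Sum>i<N. \<Sum>j<N. ip Y (T (orbit (\<alpha> i) (u i))) (T (orbit (\<alpha> j) (u j)))) =
      of_real ((hnorm Y (T z))\<^sup>2)" if T: "bounded_op Y Y T" for T
  proof -
    have mem: "T (orbit (\<alpha> j) (u j)) \<in> carrier Y" if "j < N" for j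
      using that u by (intro bounded_op_mem[OF T] orbit_mem)
    have Tz: "T z = (\<Sum>j<N. T (orbit (\<alpha> j) (u j)))"
      unfolding z_def using u by (intro bounded_op_sum[OF representation_Y representation_Y T] orbit_mem) auto
    have "of_real ((hnorm Y (T z))\<^sup>2) = ip Y (T z) (T z)"
      using z(2) by (intro Y.ip_self[symmetric] bounded_op_mem[OF T])
    also have "\<dots> = (\<Sum>i<N. \<Sum>j<N. ip Y (T (orbit (\<alpha> i) (u i))) (T (orbit (\<alpha> j) (u j))))"
      unfolding Tz using mem by (intro Y.ip_sum_sum) auto
    finally show ?thesis by simp
  qed
  have "ip H (u i) (K (\<alpha> i) (\<alpha> j) (u j) - shift_kernel K (\<alpha> i) (\<alpha> j) (u j)) =
      ip Y (P (orbit (\<alpha> i) (u i))) (P (orbit (\<alpha> j) (u j))) -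
      (\<Sum>k\<in>UNIV. ip Y (P (hadjoint Y Y (S k) (orbit (\<alpha> i) (u i))))
        (P (hadjoint Y Y (S k) (orbit (\<alpha> j) (u j)))))" if "i < N" "j < N" for i j
    using u[OF that(1)] u[OF that(2)] unfolding shift_kernel_def
    by (simp add: H.ip_diff_right H.ip_sum_right representation_K_mem H.sum_mem ip_representation orbit_snoc)
  then have "(\<Sum>i<N. \<Sum>j<N. ip H (u i) (K (\<alpha> i) (\<alpha> j) (u j) - shift_kernel K (\<alpha> i) (\<alpha> j) (u j))) =
      (\<Sum>i<N. \<Sum>j<N. ip Y (P (orbit (\<alpha> i) (u i))) (P (orbit (\<alpha> j) (u j)))) -
      (\<Sum>k\<in>UNIV. \<Sum>i<N. \<Sum>j<N. ip Y (P (hadjoint Y Y (S k) (orbit (\<alpha> i) (u i))))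
        (P (hadjoint Y Y (S k) (orbit (\<alpha> j) (u j)))))"
    by (simp add: sum_subtractf sum.swap[of _ UNIV])
  also have "\<dots> = of_real ((hnorm Y (P z))\<^sup>2) - (\<Sum>k\<in>UNIV. of_real ((hnorm Y (P (hadjoint Y Y (S k) z)))\<^sup>2))"
    by (simp only: sum[OF P_bop] sum[OF PR_bop])
  also have "0 \<le> \<dots>"
  proof -
    have "ip Y z (\<Sum>i\<in>UNIV. S i (P (hadjoint Y Y (S i) z))) \<le> ip Y z (P z)"
      using rep z(1) unfolding cuntz_representation_def op_le_on_def by blast
    then show ?thesis
      using z(2) by (simp add: ip_column[OF representation_Y representation_P representation_S]
          ip_projection[OF representation_Y representation_P] Y.ip_self
          projection_mem[OF representation_Y representation_P] less_eq_complex_def)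
  qed
  finally show "0 \<le> (\<Sum>i<N. \<Sum>j<N. ip H (u i) (K (\<alpha> i) (\<alpha> j) (u j) - shift_kernel K (\<alpha> i) (\<alpha> j) (u j)))" .
qed

lemma ip_cuntz:
  assumes "x \<in> carrier Y" "y \<in> carrier Y"
  shows "(\<Sum>i\<in>UNIV. ip Y (hadjoint Y Y (S i) x) (hadjoint Y Y (S i) y)) = ip Y x y"
proof -
  have mem: "hadjoint Y Y (S i) y \<in> carrier Y" for i
    by (rule hadjoint_mem[OF representation_Y representation_Y representation_S assms(2)])
  have "ip Y x y = ip Y x (\<Sum>i\<in>UNIV. S i (hadjoint Y Y (S i) y))"
    using assms by (simp add: representation_cuntz)
  also have "\<dots> = (\<Sum>i\<in>UNIV. ip Y x (S i (hadjoint Y Y (S i) y)))"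
    using assms mem by (intro Y.ip_sum_right bounded_op_mem[OF representation_S])
  also have "\<dots> = (\<Sum>i\<in>UNIV. ip Y (hadjoint Y Y (S i) x) (hadjoint Y Y (S i) y))"
    using assms mem
    by (simp add: ip_hadjoint_left[OF representation_Y representation_Y representation_S])
  finally show ?thesis by simp
qed

text \<open>
  If \<open>K\<^sub>\<Sigma> = K\<close>, the nonnegative numbers \<open>\<parallel>y\<parallel>\<^sup>2 - \<parallel>P y\<parallel>\<^sup>2\<close> with \<open>y\<close> running over the orbit vectors
  \<open>(S\<^sup>\<gamma>)\<^sup>* W u\<close> of a given word length have a sum that is independent of the length,
  and \<open>K(\<emptyset>, \<emptyset>) = I\<close> makes it vanish for length \<open>0\<close>.
\<close>

lemma orbit_fixed:
  assumes one: "\<And>u. u \<in> carrier H \<Longrightarrow> K [] [] u = u" and eq: "kernel_eq H (shift_kernel K) K"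
    and u: "u \<in> carrier H"
  shows "P (orbit \<gamma> u) = orbit \<gamma> u"
proof (induction \<gamma> rule: rev_induct)
  case Nil
  have "complex_of_real ((hnorm Y (P (orbit [] u)))\<^sup>2) = ip H u (K [] [] u)"
    using u by (simp add: ip_representation Y.ip_self orbit_mem
        projection_mem[OF representation_Y representation_P])
  also have "\<dots> = complex_of_real ((hnorm H u)\<^sup>2)" using u by (simp add: one H.ip_self)
  also have "hnorm H u = hnorm Y (orbit [] u)"
    using u representation_W(1)
    by (simp add: hadjoint_word_op_Nil[OF representation_Y] representation_W_mem isometry_def)
  finally show ?case
    using u by (intro projection_eqI[OF representation_Y representation_P] orbit_mem)
      (simp_all only: of_real_eq_iff)
next
  case (snoc i \<gamma>)
  have norm_P: "ip H u (K \<delta> \<delta> u) = complex_of_real ((hnorm Y (P (orbit \<delta> u)))\<^sup>2)" for \<delta>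
    using u by (simp add: ip_representation Y.ip_self orbit_mem
        projection_mem[OF representation_Y representation_P])
  have "complex_of_real (\<Sum>k\<in>UNIV. (hnorm Y (P (orbit (\<gamma> @ [k]) u)))\<^sup>2) =
      ip H u (shift_kernel K \<gamma> \<gamma> u)"
    using u by (simp add: shift_kernel_def H.ip_sum_right representation_K_mem norm_P)
  also have "\<dots> = ip H u (K \<gamma> \<gamma> u)" using eq u by (simp add: kernel_eq_def)
  also have "\<dots> = ip Y (orbit \<gamma> u) (orbit \<gamma> u)"
    using u by (simp add: ip_representation snoc)
  also have "\<dots> = complex_of_real (\<Sum>k\<in>UNIV. (hnorm Y (orbit (\<gamma> @ [k]) u))\<^sup>2)"
    using u orbit_mem[of u "\<gamma> @ [_]"]
    by (subst ip_cuntz[symmetric]) (simp_all add: orbit_mem orbit_snoc Y.ip_self)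
  finally have "(\<Sum>k\<in>UNIV. (hnorm Y (P (orbit (\<gamma> @ [k]) u)))\<^sup>2) =
      (\<Sum>k\<in>UNIV. (hnorm Y (orbit (\<gamma> @ [k]) u))\<^sup>2)"
    by (simp only: of_real_eq_iff)
  \<comment> \<open>P does not increase norms, so equality of the sums forces equality term by
    term.\<close>
  then have "(hnorm Y (P (orbit (\<gamma> @ [i]) u)))\<^sup>2 = (hnorm Y (orbit (\<gamma> @ [i]) u))\<^sup>2"
    using u hnorm_projection_le[OF representation_Y representation_P orbit_mem]
    by (intro sum_mono_inv[where f = "\<lambda>k. (hnorm Y (P (orbit (\<gamma> @ [k]) u)))\<^sup>2" and I = UNIV])
      (auto intro!: power_mono simp: orbit_mem projection_mem[OF representation_Y representation_P])
  then show ?case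
    using u by (intro projection_eqI[OF representation_Y representation_P] orbit_mem)
qed

text \<open>Forward, \<open>orbit_fixed\<close> removes P from the formula for K. Backward, K is the
  Gram kernel of the orbit vectors themselves, and the Parseval identity \<open>ip_cuntz\<close>
  sums over the appended letter.\<close>

lemma representation_kernel_eq:
  assumes one: "\<And>u. u \<in> carrier H \<Longrightarrow> K [] [] u = u"
  shows "kernel_eq H (shift_kernel K) K \<longleftrightarrow>
    kernel_eq H K (\<lambda>\<alpha> \<beta> v. hadjoint H Y W (word_op S \<alpha> (orbit \<beta> v)))"
proof
  assume "kernel_eq H (shift_kernel K) K"
  then show "kernel_eq H K (\<lambda>\<alpha> \<beta> v. hadjoint H Y W (word_op S \<alpha> (orbit \<beta> v)))"
    using orbit_fixed[OF one] by (simp add: kernel_eq_def representation_K)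
next
  assume "kernel_eq H K (\<lambda>\<alpha> \<beta> v. hadjoint H Y W (word_op S \<alpha> (orbit \<beta> v)))"
  then have K: "ip H u (K \<alpha> \<beta> v) = ip Y (orbit \<alpha> u) (orbit \<beta> v)"
    if "u \<in> carrier H" "v \<in> carrier H" for u v \<alpha> \<beta>
    using that by (simp add: kernel_eq_def ip_orbit orbit_mem)
  show "kernel_eq H (shift_kernel K) K"
    unfolding kernel_eq_def shift_kernel_def
  proof (intro allI ballI)
    fix \<alpha> \<beta> v
    assume v: "v \<in> carrier H"
    show "(\<Sum>i\<in>UNIV. K (\<alpha> @ [i]) (\<beta> @ [i]) v) = K \<alpha> \<beta> v"
    proof (rule H.ip_ext)
      fix u assume u: "u \<in> carrier H"
      show "ip H u (\<Sum>i\<in>UNIV. K (\<alpha> @ [i]) (\<beta> @ [i]) v) = ip H u (K \<alpha> \<beta> v)"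
        using u v by (simp add: H.ip_sum_right representation_K_mem K orbit_snoc ip_cuntz orbit_mem)
    qed (use v in \<open>auto intro!: H.sum_mem representation_K_mem\<close>)
  qed
qed

end

section \<open>Moment kernels: normalization and positivity\<close>

context
  fixes M :: "'w measure" and H :: "'h::ab_group_add inner_space"
    and A :: "'d::finite \<Rightarrow> 'w \<Rightarrow> 'h \<Rightarrow> 'h" and K :: "('d, 'h) kernel"
  assumes M: "prob_space M" and H: "hilbert_space H" and K: "moment_kernel M H A K"
begin

interpretation prob_space M by (rule M)
interpretation H: hilbert_space H by (rule H)

text \<open>The empty word gives the identity operator and the total mass is 1. This makes W
  isometric and starts the induction in \<open>orbit_fixed\<close>.\<close>

lemma moment_kernel_Nil: "u \<in> carrier H \<Longrightarrow> K [] [] u = u"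
proof (rule H.ip_ext)
  assume u: "u \<in> carrier H"
  show "K [] [] u \<in> carrier H" using K u unfolding moment_kernel_def bounded_op_def by blast
  fix w assume w: "w \<in> carrier H"
  have "has_bochner_integral M (\<lambda>\<omega>. ip H w (word_op (\<lambda>i. A i \<omega>) [] (hadjoint H H (word_op (\<lambda>i. A i \<omega>) []) u)))
      (ip H w (K [] [] u))"
    using K u w unfolding moment_kernel_def by blast
  then have "has_bochner_integral M (\<lambda>\<omega>. ip H w u) (ip H w (K [] [] u))"
    using hadjoint_word_op_Nil[OF H u] by (simp add: word_op_Nil)
  then have "integral\<^sup>L M (\<lambda>\<omega>. ip H w u) = ip H w (K [] [] u)"
    by (rule has_bochner_integral_integral_eq)
  then show "ip H w (K [] [] u) = ip H w u" by (simp add: prob_space)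
qed auto

text \<open>Pointwise, the form is the squared norm of a sum of adjoint words applied to the
  vectors, and the weak expectation integrates exactly this number.\<close>

lemma moment_kernel_positive_definite:
  assumes A: "\<forall>i. random_operator M H (A i)"
  shows "positive_definite H K"
  unfolding positive_definite_def
proof (intro allI impI)
  fix N :: nat and \<alpha> :: "nat \<Rightarrow> 'd list" and u
  assume u: "\<forall>j<N. u j \<in> carrier H"
  let ?T = "\<lambda>\<omega> \<alpha>. word_op (\<lambda>i. A i \<omega>) \<alpha>"
  let ?F = "\<lambda>\<omega>. \<Sum>i<N. \<Sum>j<N. ip H (u i) (?T \<omega> (\<alpha> i) (hadjoint H H (?T \<omega> (\<alpha> j)) (u j)))"
  let ?k = "\<Sum>i<N. \<Sum>j<N. ip H (u i) (K (\<alpha> i) (\<alpha> j) (u j))"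
  have "0 \<le> ?F \<omega>" if \<omega>: "\<omega> \<in> space M" for \<omega>
  proof -
    have T: "bounded_op H H (?T \<omega> \<gamma>)" for \<gamma>
      using A \<omega> by (intro bounded_op_word_op[OF H]) (auto simp: random_operator_def)
    let ?y = "\<lambda>j. hadjoint H H (?T \<omega> (\<alpha> j)) (u j)"
    have y: "?y j \<in> carrier H" if "j < N" for j
      using u that by (intro hadjoint_mem[OF H H T]) auto
    have "?F \<omega> = (\<Sum>i<N. \<Sum>j<N. ip H (?y i) (?y j))"
      using u y by (intro sum.cong refl) (simp add: ip_hadjoint_left[OF H H T])
    also have "\<dots> = ip H (\<Sum>i<N. ?y i) (\<Sum>j<N. ?y j)"
      using y by (intro H.ip_sum_sum[symmetric]) auto
    also have "0 \<le> \<dots>" using y by (intro H.ip_self_nonneg H.sum_mem) auto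
    finally show ?thesis .
  qed
  \<comment> \<open>The order on complex numbers includes being real, so real and imaginary parts
    are integrated separately.\<close>
  then have F: "0 \<le> Re (?F \<omega>)" "Im (?F \<omega>) = 0" if "\<omega> \<in> space M" for \<omega>
    using that by (simp_all only: less_eq_complex_def) auto
  have int: "has_bochner_integral M ?F ?k"
    using K u unfolding moment_kernel_def by (intro has_bochner_integral_sum) auto
  have "has_bochner_integral M (\<lambda>\<omega>. Re (?F \<omega>)) (Re ?k)"
    by (rule has_bochner_integral_bounded_linear[OF bounded_linear_Re int])
  then have "Re ?k = (\<integral>\<omega>. Re (?F \<omega>) \<partial>M)" by (simp only: has_bochner_integral_integral_eq)
  moreover have "0 \<le> (\<integral>\<omega>. Re (?F \<omega>) \<partial>M)" using F(1) by (intro integral_nonneg_AE AE_I2) 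
  moreover have "has_bochner_integral M (\<lambda>\<omega>. Im (?F \<omega>)) (Im ?k)"
    by (rule has_bochner_integral_bounded_linear[OF bounded_linear_Im int])
  then have "Im ?k = (\<integral>\<omega>. Im (?F \<omega>) \<partial>M)" by (simp only: has_bochner_integral_integral_eq)
  moreover have "(\<integral>\<omega>. Im (?F \<omega>) \<partial>M) = (\<integral>\<omega>. 0 \<partial>M)" using F(2) by (rule Bochner_Integration.integral_cong[OF refl])
  ultimately show "0 \<le> ?k" by (simp add: less_eq_complex_def)
qed

end

section \<open>Construction of the Cuntz representation\<close>

definition carrier_part :: "'h::ab_group_add inner_space \<Rightarrow> 'h \<Rightarrow> 'h" where
  "carrier_part H u = (if u \<in> carrier H then u else 0)"

text \<open>The index type contains vectors outside \<open>carrier H\<close>. Reading them as 0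
  gives a kernel on the whole type and keeps positivity.\<close>

definition scalar_kernel ::
  "'h::ab_group_add inner_space \<Rightarrow> ('d, 'h) kernel \<Rightarrow> 'd list \<times> 'h \<Rightarrow> 'd list \<times> 'h \<Rightarrow> complex" where
  "scalar_kernel H L p q =
    ip H (carrier_part H (snd p)) (L (fst p) (fst q) (carrier_part H (snd q)))"

lemma pos_scalar_kernel:
  assumes H: "hilbert_space H" and L: "positive_definite H L"
    and mem: "\<And>\<alpha> \<beta> u. u \<in> carrier H \<Longrightarrow> L \<alpha> \<beta> u \<in> carrier H"
    and scale: "\<And>\<alpha> \<beta> a u. u \<in> carrier H \<Longrightarrow> L \<alpha> \<beta> (scale H a u) = scale H a (L \<alpha> \<beta> u)"
  shows "pos_kernel (scalar_kernel H L)"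
  unfolding pos_kernel_def
proof
  interpret H: hilbert_space H by (rule H)
  have part [simp]: "carrier_part H u \<in> carrier H" for u by (simp add: carrier_part_def)
  fix l :: "(complex \<times> 'b list \<times> 'a) list"
  define \<alpha> where "\<alpha> i = fst (snd (l ! i))" for i
  \<comment> \<open>The coefficients are absorbed into the vectors, since
    \<open>positive_definite\<close> speaks of vectors alone.\<close>
  define u where "u i = scale H (fst (l ! i)) (carrier_part H (snd (snd (l ! i))))" for i
  have "kernel_form (scalar_kernel H L) l l =
      (\<Sum>i<length l. \<Sum>j<length l. ip H (u i) (L (\<alpha> i) (\<alpha> j) (u j)))"
    unfolding kernel_form_def sum_list_sum_nth
    by (simp add: split_def lessThan_atLeast0 scalar_kernel_def \<alpha>_def u_def scale mem
        H.ip_scale H.ip_scale_left mult_ac)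
  also have "0 \<le> \<dots>"
    using L unfolding positive_definite_def by (auto simp: u_def)
  finally show "0 \<le> kernel_form (scalar_kernel H L) l l" .
qed

text \<open>Words and levels are countable in number and \<open>'d list \<times> 'h\<close> is
  infinite, so adding them as indices does not raise the cardinality. Thus the dilation fits into
  functions on \<open>'d list \<times> 'h\<close>.\<close>

lemma surj_index:
  includes cardinal_syntax
  shows "\<exists>c :: 'd::finite list \<times> 'h \<Rightarrow> 'd list \<times> nat \<times> 'd list \<times> 'h. surj c"
proof -
  let ?X = "UNIV :: ('d list \<times> 'h) set" and ?B = "UNIV :: ('d list \<times> nat) set"
  have inf: "infinite ?X" by (simp add: finite_prod infinite_UNIV_listI)
  have "|?B| \<le>o |UNIV :: nat set|"
    by (rule card_of_ordLeqI[of to_nat]) auto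
  also have "|UNIV :: nat set| \<le>o |?X|" using inf by (simp add: infinite_iff_card_of_nat)
  finally have "|?X \<times> ?B| =o |?X|" using inf card_of_Times_infinite[of ?X ?B] by simp
  then obtain f where f: "bij_betw f (?X \<times> ?B) ?X" using card_of_ordIso by blast
  define g where "g p = f ((fst (snd (snd p)), snd (snd (snd p))), (fst p, fst (snd p)))"
    for p :: "'d list \<times> nat \<times> 'd list \<times> 'h"
  have "inj g"
    using bij_betw_imp_inj_on[OF f] by (auto simp: inj_on_def g_def)
  then have "surj (inv g)" by (rule inj_imp_surj_inv)
  then show ?thesis by blast
qed

text \<open>The closure properties of E are those needed to show by induction on the word that an
  orbit vector differs from the corresponding v by an element of E. P then removes the error, and
  the norms in (1) become Gram forms of K.\<close>

lemma cuntz_representation_of_dilation: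
  fixes H :: "'h::ab_group_add inner_space" and K :: "('d::finite, 'h) kernel"
    and Y :: "'b::ab_group_add inner_space" and S :: "'d \<Rightarrow> 'b \<Rightarrow> 'b"
  defines "\<sigma> \<equiv> \<lambda>i p. (fst p @ [i], snd p)"
  assumes H: "hilbert_space H" and Y: "hilbert_space Y"
    and S: "cuntz_family Y S" and P: "orth_projection Y P"
    and bop: "\<And>\<alpha> \<beta>. bounded_op H H (K \<alpha> \<beta>)"
    and one: "\<And>u. u \<in> carrier H \<Longrightarrow> K [] [] u = u"
    and v: "\<And>x. v x \<in> carrier Y" "\<And>x. P (v x) = v x"
    and ip_v: "\<And>x y. ip Y (v x) (v y) = scalar_kernel H K x y"
    and E: "\<And>g. g \<in> E \<Longrightarrow> g \<in> carrier Y" "\<And>g. g \<in> E \<Longrightarrow> P g = 0"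
      "\<And>g i. g \<in> E \<Longrightarrow> hadjoint Y Y (S i) g \<in> E" "0 \<in> E"
      "\<And>g h. \<lbrakk>g \<in> E; h \<in> E\<rbrakk> \<Longrightarrow> g + h \<in> E"
      "\<And>i x. hadjoint Y Y (S i) (v x) - v (\<sigma> i x) \<in> E"
    and D: "pos_kernel (\<lambda>x y. scalar_kernel H K x y -
      (\<Sum>i\<in>UNIV. scalar_kernel H K (\<sigma> i x) (\<sigma> i y)))"
  shows "cuntz_representation H K Y S P (\<lambda>u. v ([], u))"
proof -
  interpret H: hilbert_space H by (rule H)
  interpret Y: hilbert_space Y by (rule Y)
  interpret V: vector_space "scale Y" by (rule Y.vector_space)
  define W where "W u = v ([], u)" for u
  let ?R = "\<lambda>i. hadjoint Y Y (S i)"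
  have S_bop: "bounded_op Y Y (S i)" for i using S by (simp add: cuntz_family_def)
  have word_bop: "bounded_op Y Y (word_op S \<alpha>)" for \<alpha>
    by (rule bounded_op_word_op[OF Y S_bop])
  have R_bop: "bounded_op Y Y (?R i)" for i by (rule bounded_op_hadjoint[OF Y Y S_bop])
  have P_bop: "bounded_op Y Y P" by (rule bounded_op_projection[OF Y P])
  have PR_bop: "bounded_op Y Y (\<lambda>y. P (?R i y))" for i by (rule bounded_op_comp[OF Y R_bop P_bop])
  have P_mem: "P y \<in> carrier Y" if "y \<in> carrier Y" for y by (rule projection_mem[OF Y P that])
  have W_mem: "W u \<in> carrier Y" for u by (simp add: W_def v)
  let ?o = "\<lambda>\<alpha> u. hadjoint Y Y (word_op S \<alpha>) (W u)"
  have o_mem: "?o \<alpha> u \<in> carrier Y" for \<alpha> u by (rule hadjoint_mem[OF Y Y word_bop W_mem])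
  have o_snoc: "?o (\<alpha> @ [i]) u = ?R i (?o \<alpha> u)" for \<alpha> i u
    by (rule hadjoint_word_op_snoc[OF Y S_bop W_mem])
  have o_E: "?o \<alpha> u - v (\<alpha>, u) \<in> E" for \<alpha> u
  proof (induction \<alpha> rule: rev_induct)
    case Nil
    then show ?case by (simp add: hadjoint_word_op_Nil[OF Y W_mem]) (simp add: W_def E)
  next
    case (snoc i \<alpha>)
    have "?o (\<alpha> @ [i]) u - v (\<alpha> @ [i], u) =
        ?R i (?o \<alpha> u - v (\<alpha>, u)) + (?R i (v (\<alpha>, u)) - v (\<sigma> i (\<alpha>, u)))"
      by (simp add: o_snoc bounded_op_diff[OF Y Y R_bop o_mem v(1)] \<sigma>_def)
    then show ?case using E(3)[OF snoc] E(5,6) by simp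
  qed
  have P_o: "P (?o \<alpha> u) = v (\<alpha>, u)" for \<alpha> u
    using E(2)[OF o_E[of \<alpha> u]] by (simp add: bounded_op_diff[OF Y Y P_bop o_mem v(1)] v(2))
  have scalar: "scalar_kernel H K (\<alpha>, u) (\<beta>, w) = ip H u (K \<alpha> \<beta> w)"
    if "u \<in> carrier H" "w \<in> carrier H" for \<alpha> \<beta> u w
    using that by (simp add: scalar_kernel_def carrier_part_def)
  have iso: "isometry H Y W"
    by (rule isometryI[OF H Y W_mem]) (simp add: W_def ip_v scalar one)
  then have W_bop: "bounded_op H Y W" by (simp add: isometry_def)
  have "K \<alpha> \<beta> w = hadjoint H Y W (word_op S \<alpha> (P (?o \<beta> w)))" if w: "w \<in> carrier H" for \<alpha> \<beta> w
  proof (rule H.ip_ext)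
    have mem: "word_op S \<alpha> (P (?o \<beta> w)) \<in> carrier Y"
      by (intro bounded_op_mem[OF word_bop] P_mem o_mem)
    show "K \<alpha> \<beta> w \<in> carrier H" by (rule bounded_op_mem[OF bop w])
    show "hadjoint H Y W (word_op S \<alpha> (P (?o \<beta> w))) \<in> carrier H"
      by (rule hadjoint_mem[OF H Y W_bop mem])
    fix u assume u: "u \<in> carrier H"
    have "ip H u (hadjoint H Y W (word_op S \<alpha> (P (?o \<beta> w)))) = ip Y (W u) (word_op S \<alpha> (P (?o \<beta> w)))"
      by (rule ip_hadjoint_right[OF H Y W_bop mem u])
    also have "\<dots> = ip Y (?o \<alpha> u) (P (?o \<beta> w))"
      by (rule ip_hadjoint_left[OF Y Y word_bop W_mem P_mem[OF o_mem], symmetric])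
    also have "\<dots> = ip Y (P (?o \<alpha> u)) (P (?o \<beta> w))" by (rule ip_projection[OF Y P o_mem o_mem])
    also have "\<dots> = ip H u (K \<alpha> \<beta> w)" using u w by (simp add: P_o ip_v scalar)
    finally show "ip H u (K \<alpha> \<beta> w) = ip H u (hadjoint H Y W (word_op S \<alpha> (P (?o \<beta> w))))" by simp
  qed
  then have repK: "kernel_eq H K (\<lambda>\<alpha> \<beta> w. hadjoint H Y W (word_op S \<alpha> (P (?o \<beta> w))))"
    by (simp add: kernel_eq_def)
  let ?B = "{?o \<gamma> h | \<gamma> h. h \<in> carrier H}"
  have span: "y \<in> carrier Y \<and> (\<Sum>i\<in>UNIV. (hnorm Y (P (?R i y)))\<^sup>2) \<le> (hnorm Y (P y))\<^sup>2"
    if y: "y \<in> V.span ?B" for y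
  proof -
    \<comment> \<open>A single l serves \<open>P y\<close> and all \<open>P (?R i y)\<close>, so the
      gap between their squared norms is the defect form at l.\<close>
    have "y \<in> carrier Y \<and> (\<exists>l. P y = lincomb Y v l \<and> (\<forall>i. P (?R i y) = lincomb Y (\<lambda>x. v (\<sigma> i x)) l))"
      using y
    proof (induction rule: V.span_induct_alt)
      case base
      show ?case
        by (auto intro!: exI[of _ "[]"] simp: bounded_op_zero[OF Y Y P_bop] bounded_op_zero[OF Y Y PR_bop])
    next
      case (step a x y)
      then obtain \<gamma> h where x: "x = ?o \<gamma> h" by blast
      from step obtain l where y: "y \<in> carrier Y" and l: "P y = lincomb Y v l"
        "\<And>i. P (?R i y) = lincomb Y (\<lambda>x. v (\<sigma> i x)) l" by blast
      have ax: "scale Y a x \<in> carrier Y" by (simp add: x o_mem)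
      have "P (scale Y a x + y) = lincomb Y v ((a, \<gamma>, h) # l)"
        using bounded_op_add[OF P_bop ax y] by (simp add: x l bounded_op_scale[OF P_bop o_mem] P_o)
      moreover have "P (?R i (scale Y a x + y)) = lincomb Y (\<lambda>x. v (\<sigma> i x)) ((a, \<gamma>, h) # l)" for i
        using bounded_op_add[OF PR_bop ax y, of i]
        by (simp add: x l bounded_op_scale[OF PR_bop o_mem] o_snoc[symmetric] P_o \<sigma>_def)
      ultimately show ?case using ax y by (auto intro!: exI[of _ "(a, \<gamma>, h) # l"])
    qed
    then obtain l where "y \<in> carrier Y" and l: "P y = lincomb Y v l"
      "\<And>i. P (?R i y) = lincomb Y (\<lambda>x. v (\<sigma> i x)) l" by blast
    let ?k = "scalar_kernel H K"
    have "(hnorm Y (P y))\<^sup>2 = Re (kernel_form ?k l l)"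
      unfolding l by (simp add: Y.hnorm_square Y.lincomb_mem v(1) Y.ip_lincomb ip_v)
    moreover have "(hnorm Y (P (?R i y)))\<^sup>2 = Re (kernel_form (\<lambda>x y. ?k (\<sigma> i x) (\<sigma> i y)) l l)" for i
      unfolding l by (simp add: Y.hnorm_square Y.lincomb_mem v(1) Y.ip_lincomb ip_v)
    moreover have "0 \<le> kernel_form (\<lambda>x y. ?k x y - (\<Sum>i\<in>UNIV. ?k (\<sigma> i x) (\<sigma> i y))) l l"
      using D by (simp add: pos_kernel_def)
    ultimately show ?thesis
      using \<open>y \<in> carrier Y\<close> by (simp add: kernel_form_diff kernel_form_sum less_eq_complex_def)
  qed
  have "ip Y y (\<Sum>i\<in>UNIV. S i (P (?R i y))) \<le> ip Y y (P y)" if y: "y \<in> adjoint_orbit_span H Y S W" for y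
  proof -
    from y obtain s :: "nat \<Rightarrow> 'b" where y: "y \<in> carrier Y" and s: "\<And>n. s n \<in> V.span ?B"
      "(\<lambda>n. hnorm Y (s n - y)) \<longlonglongrightarrow> 0"
      unfolding adjoint_orbit_span_def closed_span_def by blast
    have sY: "s n \<in> carrier Y" for n using span[OF s(1)] by blast
    \<comment> \<open>Both sides are continuous, so the inequality passes from the span to its
      closure.\<close>
    have "(\<lambda>n. \<Sum>i\<in>UNIV. (hnorm Y (P (?R i (s n))))\<^sup>2) \<longlonglongrightarrow> (\<Sum>i\<in>UNIV. (hnorm Y (P (?R i y)))\<^sup>2)"
      by (intro tendsto_sum tendsto_power bounded_op_tendsto_hnorm[OF Y Y PR_bop sY y s(2)])
    moreover have "(\<lambda>n. (hnorm Y (P (s n)))\<^sup>2) \<longlonglongrightarrow> (hnorm Y (P y))\<^sup>2"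
      by (intro tendsto_power bounded_op_tendsto_hnorm[OF Y Y P_bop sY y s(2)])
    ultimately have "(\<Sum>i\<in>UNIV. (hnorm Y (P (?R i y)))\<^sup>2) \<le> (hnorm Y (P y))\<^sup>2"
      by (rule LIMSEQ_le) (use span[OF s(1)] in blast)
    then show ?thesis
      using y by (simp add: ip_column[OF Y P S_bop] ip_projection[OF Y P] Y.ip_self P_mem
          less_eq_complex_def)
  qed
  then have "op_le_on Y (adjoint_orbit_span H Y S W) (\<lambda>y. \<Sum>i\<in>UNIV. S i (P (?R i y))) P"
    by (simp add: op_le_on_def)
  then have "cuntz_representation H K Y S P W"
    unfolding cuntz_representation_def using Y S P iso repK by blast
  then show ?thesis by (simp add: W_def[abs_def])
qed

lemma cuntz_representation_exists:
  fixes H :: "'h::ab_group_add inner_space" and K :: "('d::finite, 'h) kernel"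
  assumes H: "hilbert_space H" and K: "positive_definite H K"
    and le: "kernel_le H (shift_kernel K) K"
    and bop: "\<And>\<alpha> \<beta>. bounded_op H H (K \<alpha> \<beta>)"
    and one: "\<And>u. u \<in> carrier H \<Longrightarrow> K [] [] u = u"
  shows "\<exists>(Y :: ('d list \<times> 'h \<Rightarrow> complex) inner_space) S P W. cuntz_representation H K Y S P W"
proof -
  interpret H: hilbert_space H by (rule H)
  define \<sigma> where "\<sigma> i p = (fst p @ [i], snd p)" for i :: 'd and p :: "'d list \<times> 'h"
  let ?k = "scalar_kernel H K"
  let ?D = "\<lambda>x y. ?k x y - (\<Sum>i\<in>UNIV. ?k (\<sigma> i x) (\<sigma> i y))"
  have part [simp]: "carrier_part H u \<in> carrier H" for u by (simp add: carrier_part_def)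
  have K_mem [simp]: "K \<alpha> \<beta> u \<in> carrier H" if "u \<in> carrier H" for \<alpha> \<beta> u
    using bounded_op_mem[OF bop that] .
  have pos: "pos_kernel ?k"
    using bounded_op_scale[OF bop] by (intro pos_scalar_kernel H K) auto
  have "pos_kernel (scalar_kernel H (\<lambda>\<alpha> \<beta> u. K \<alpha> \<beta> u - shift_kernel K \<alpha> \<beta> u))"
  proof (rule pos_scalar_kernel[OF H])
    interpret V: vector_space "scale H" by (rule H.vector_space)
    show "positive_definite H (\<lambda>\<alpha> \<beta> u. K \<alpha> \<beta> u - shift_kernel K \<alpha> \<beta> u)"
      using le by (simp add: kernel_le_def)
    fix \<alpha> \<beta> u a
    assume u: "u \<in> carrier H"
    then show "K \<alpha> \<beta> u - shift_kernel K \<alpha> \<beta> u \<in> carrier H"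
      by (simp add: shift_kernel_def H.sum_mem)
    show "K \<alpha> \<beta> (scale H a u) - shift_kernel K \<alpha> \<beta> (scale H a u) =
        scale H a (K \<alpha> \<beta> u - shift_kernel K \<alpha> \<beta> u)"
      using u by (simp add: shift_kernel_def bounded_op_scale[OF bop] V.scale_right_diff_distrib
          V.scale_sum_right)
  qed
  \<comment> \<open>Since \<open>\<sigma> i\<close> appends i to the word, the shifted kernel
    becomes the sum of pulled back scalar kernels that the dilation expects.\<close>
  also have "scalar_kernel H (\<lambda>\<alpha> \<beta> u. K \<alpha> \<beta> u - shift_kernel K \<alpha> \<beta> u) = ?D"
    by (intro ext) (simp add: scalar_kernel_def shift_kernel_def \<sigma>_def H.ip_diff_right
        H.ip_sum_right H.sum_mem)
  finally have D: "pos_kernel ?D" .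
  obtain c :: "'d list \<times> 'h \<Rightarrow> 'd list \<times> nat \<times> 'd list \<times> 'h" where c: "surj c"
    using surj_index by blast
  from cuntz_dilation[OF pos D c] obtain Y :: "('d list \<times> 'h \<Rightarrow> complex) inner_space"
    and S :: "'d \<Rightarrow> _" and P v E
    where Y: "hilbert_space Y" and S: "cuntz_family Y S" and P: "orth_projection Y P"
      and v': "\<forall>x. v x \<in> carrier Y \<and> P (v x) = v x" and ip_v': "\<forall>x y. ip Y (v x) (v y) = ?k x y"
      and E': "\<forall>g\<in>E. g \<in> carrier Y \<and> P g = 0 \<and> (\<forall>i. hadjoint Y Y (S i) g \<in> E)"
      and E_0: "0 \<in> E" and E_add': "\<forall>g\<in>E. \<forall>h\<in>E. g + h \<in> E"
      and E_v': "\<forall>i x. hadjoint Y Y (S i) (v x) - v (\<sigma> i x) \<in> E"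
    by blast
  have "cuntz_representation H K Y S P (\<lambda>u. v ([], u))"
    by (rule cuntz_representation_of_dilation[where H = H and Y = Y and K = K and S = S and
          P = P and v = v and E = E, OF H Y S P bop one])
      (use D v' ip_v' E' E_0 E_add' E_v' in \<open>simp_all add: \<sigma>_def del: split_paired_All\<close>)
  then show ?thesis by blast
qed

theorem theorem2p1:
  fixes M :: "'w measure"
    and H :: "'h::ab_group_add inner_space"
    and A :: "'d::finite \<Rightarrow> 'w \<Rightarrow> 'h \<Rightarrow> 'h"
    and K :: "('d, 'h) kernel"
  assumes "prob_space M"
    and "hilbert_space H"
    and "\<forall>i. random_operator M H (A i)"
    and "\<forall>\<alpha>. integrable M (\<lambda>\<omega>. (op_norm H (word_op (\<lambda>i. A i \<omega>) \<alpha>))\<^sup>2)"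
    and "moment_kernel M H A K"
  shows "((\<exists>(Y :: ('d list \<times> 'h \<Rightarrow> complex) inner_space) S P W. cuntz_representation H K Y S P W)
          \<longleftrightarrow> kernel_le H (shift_kernel K) K)
       \<and> ((\<exists>(Y :: 'k::ab_group_add inner_space) S P W. cuntz_representation H K Y S P W)
          \<longrightarrow> kernel_le H (shift_kernel K) K)
       \<and> (\<forall>(Y :: 'k inner_space) S P W. cuntz_representation H K Y S P W \<longrightarrow>
            (kernel_eq H (shift_kernel K) K \<longleftrightarrow>
             kernel_eq H K
               (\<lambda>\<alpha> \<beta> v. hadjoint H Y W (word_op S \<alpha> (hadjoint Y Y (word_op S \<beta>) (W v))))))"
proof (intro conjI iffI impI allI)
  note one = moment_kernel_Nil[OF assms(1,2,5)]
  have bop: "bounded_op H H (K \<alpha> \<beta>)" for \<alpha> \<beta>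
    using assms(5) by (simp add: moment_kernel_def)
  show "\<exists>(Y :: ('d list \<times> 'h \<Rightarrow> complex) inner_space) S P W. cuntz_representation H K Y S P W"
    if "kernel_le H (shift_kernel K) K"
    using assms(2) moment_kernel_positive_definite[OF assms(1,2,5,3)] that bop one
    by (rule cuntz_representation_exists)
  fix Y :: "'k inner_space" and S P W
  assume rep: "cuntz_representation H K Y S P W"
  note eq = representation_kernel_eq[OF assms(2) rep one]
  {
    assume "kernel_eq H (shift_kernel K) K"
    with eq show "kernel_eq H K
        (\<lambda>\<alpha> \<beta> v. hadjoint H Y W (word_op S \<alpha> (hadjoint Y Y (word_op S \<beta>) (W v))))" by blast
  next
    assume "kernel_eq H K
        (\<lambda>\<alpha> \<beta> v. hadjoint H Y W (word_op S \<alpha> (hadjoint Y Y (word_op S \<beta>) (W v))))"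
    with eq show "kernel_eq H (shift_kernel K) K" by blast
  }
qed (use representation_kernel_le[OF assms(2)] in blast)+

end
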